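(* Consider a one-body quantum flow determined by $(\rho,S)$, with $\rho_m,\eta,P,p,\mathbf u,\mathbf v,\mathbf w=\mathbf u+\mathbf v$ as in the context and a real potential $U$. Under the condition that the continuity equation $\partial\rho+\nabla\cdot(\rho\mathbf v)=0$ is satisfied, the following three equations are equivalent: 1) $\rho_m\partial\mathbf v+\tfrac12\rho_m\nabla(|\mathbf u|^2+|\mathbf v|^2)+\nabla P+\big(\nabla\cdot(\rho_m\mathbf u)\big)\mathbf u+\rho\nabla U=\mathbf 0$; 2) $\rho_m\partial\mathbf w+\tfrac12\rho_m\nabla|\mathbf w|^2+\nabla P+\rho\nabla U+\big(\nabla\cdot(\rho_m\mathbf u)\big)\mathbf u=\eta\nabla(\nabla\cdot\mathbf v)$; 3) $\partial(\rho_m\mathbf u)+\rho_m\partial\mathbf v+\tfrac12\rho_m\nabla(|\mathbf u|^2+|\mathbf v|^2)+\nabla(P+p)+\big(\nabla\cdot(\rho_m\mathbf u)\big)\mathbf u+\rho\nabla U=\mathbf 0$. Also, equation 2) is equivalent to $$\mathcal D\!\int_{\mathbb V}\rho_m\mathbf w-\int_{\mathbb V}\big(\nabla\cdot(\rho_m\mathbf u)\big)\mathbf v=\int_{\mathbb V}\big[-\nabla P-\rho\nabla U+\eta\nabla(\nabla\cdot\mathbf v)\big],$$ and equation 3) is equivalent to $$-\int_{\mathbb V}\big(\nabla\cdot(\rho_m\mathbf v)\big)\mathbf u+\mathcal D\!\int_{\mathbb V}\rho_m\mathbf w-\int_{\mathbb V}\big[\big(\nabla\cdot(\rho_m\mathbf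 u)\big)\mathbf v+\rho_m\nabla(\mathbf u\cdot\mathbf v)\big]=\int_{\mathbb V}\big[-\nabla P-\nabla p-\rho\nabla U+\eta\nabla(\nabla\cdot\mathbf v)\big].$$
   Context: Constants $\hbar,m>0$. $\partial=\partial/\partial t$ and $\nabla$ is the gradient in $\mathbf r\in\mathbb R^3$. $\rho\ge0$ and $S$ are real functions on $\mathbb R\times\mathbb R^3$ (time and space), twice continuously differentiable almost everywhere (a spin variable, if present, is a fixed parameter), with $\int\rho=1$; the zero set of $\rho$ has measure zero for each time. All equalities are understood almost everywhere. Definitions: $\zeta_0=\hbar/2$, $\zeta=\zeta_0/m$, $\rho_m=m\rho$, $\eta=\zeta_0\rho$; $\mathbf v=\frac1m\nabla S$, $\mathbf u=-\zeta\,\nabla\rho/\rho$; $P=\zeta_0\nabla\cdot(\rho\mathbf u)$, $p=-\zeta_0\nabla\cdot(\rho\mathbf v)$. The one-body quantum flow is the collection $(P,\rho_m,\mathbf u,\mathbf v)$ so determined by $(\rho,S)$. $\mathbb V=\mathbb V(t)\subset\mathbb R^3$ is a time-dependent region occupied by the fluid, which may have variable mass and has velocity field $\mathbf w$; $\mathcal D$ is the total time derivative (following the fluid), so that $\mathcal D\int_{\mathbb V}\rho_m\mathbf w=\int_{\mathbb V}[\partial(\rho_m\mathbf w)+\rho_m(\mathbf w\cdot\nabla)\mathbf w+(\nabla\cdot(\rho_m\mathbf w))\mathbf w]$.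
   Formalization: The last integral equation is stated without η∇(∇·v), with which the equivalence is false; P and U are assumed spatially differentiable a.e. and U measurable; integral forms range over all measurable regions moving with w that obey the transport formula and whose integrals exist. *)

theory Defs
  imports "HOL-Analysis.Analysis"
begin

text \<open>Scalar and vector fields on space-time are curried functions of time and position.\<close>

type_synonym scalar_field = "real \<Rightarrow> real ^ 3 \<Rightarrow> real"
type_synonym vector_field = "real \<Rightarrow> real ^ 3 \<Rightarrow> real ^ 3"

definition C2_on :: "('a::real_normed_vector \<Rightarrow> real) \<Rightarrow> 'a set \<Rightarrow> bool" where
  "C2_on f W \<longleftrightarrow>
     (\<exists>f' :: 'a \<Rightarrow> ('a \<Rightarrow>\<^sub>L real). \<exists>f'' :: 'a \<Rightarrow> ('a \<Rightarrow>\<^sub>L ('a \<Rightarrow>\<^sub>L real)).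
        (\<forall>z\<in>W. (f has_derivative blinfun_apply (f' z)) (at z)) \<and>
        (\<forall>z\<in>W. (f' has_derivative blinfun_apply (f'' z)) (at z)) \<and>
        continuous_on W f'')"

text \<open>Continuity of the second derivative at a point presupposes its existence nearby, so
  ``twice continuously differentiable almost everywhere'' asks for a neighbourhood of almost
  every point; equivalently, for an open set with null complement.\<close>

definition C2_ae :: "('a::euclidean_space \<Rightarrow> real) \<Rightarrow> bool" where
  "C2_ae f \<longleftrightarrow> (AE z in lborel. \<exists>W. open W \<and> z \<in> W \<and> C2_on f W)"

definition time_deriv :: "(real \<Rightarrow> real ^ 3 \<Rightarrow> 'b::real_normed_vector) \<Rightarrow> real \<Rightarrow> real ^ 3 \<Rightarrow> 'b" where
  "time_deriv f t x = vector_derivative (\<lambda>s. f s x) (at t)"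

definition grad :: "scalar_field \<Rightarrow> vector_field" where
  "grad f t x = (THE g. GDERIV (f t) x :> g)"

definition divg :: "vector_field \<Rightarrow> scalar_field" where
  "divg F t x = trace (jacobian (F t) (at x))"

definition convect :: "vector_field \<Rightarrow> vector_field \<Rightarrow> vector_field" where
  "convect a F t x = frechet_derivative (F t) (at x) (a t x)"

definition total_deriv :: "(real \<Rightarrow> (real ^ 3) set) \<Rightarrow> vector_field \<Rightarrow> real \<Rightarrow> real ^ 3" where
  "total_deriv V f t = vector_derivative (\<lambda>s. LINT x:V s|lebesgue. f s x) (at t)"

text \<open>The integrand in the transport formula for the momentum of a fluid of variable mass: the
  last term is present because the mass density need not obey a continuity equation with
  velocity \<open>w\<close>.\<close>

definition momentum_transport :: "scalar_field \<Rightarrow> vector_field \<Rightarrow> vector_field" where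
  "momentum_transport \<rho>\<^sub>m w t x =
     time_deriv (\<lambda>s y. \<rho>\<^sub>m s y *\<^sub>R w s y) t x
     + \<rho>\<^sub>m t x *\<^sub>R convect w w t x
     + divg (\<lambda>s y. \<rho>\<^sub>m s y *\<^sub>R w s y) t x *\<^sub>R w t x"

text \<open>\<open>V\<close> is, at the instant \<open>t\<close>, a region moving with the fluid: for times \<open>s\<close> close to \<open>t\<close> it
  consists of the positions \<open>\<phi> s x\<close> of the particles that are at \<open>x \<in> V t\<close> at time \<open>t\<close>, and these
  have velocity \<open>w t x\<close> at time \<open>t\<close>.  A derivative at time \<open>t\<close> depends on the motion only through
  this instantaneous velocity.\<close>

definition moves_with :: "vector_field \<Rightarrow> (real \<Rightarrow> (real ^ 3) set) \<Rightarrow> real \<Rightarrow> bool" where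
  "moves_with w V t \<longleftrightarrow>
     (\<exists>\<phi> :: real \<Rightarrow> real ^ 3 \<Rightarrow> real ^ 3.
        (\<forall>x\<in>V t. \<phi> t x = x \<and> ((\<lambda>s. \<phi> s x) has_vector_derivative w t x) (at t)) \<and>
        (\<forall>\<^sub>F s in nhds t. V s = \<phi> s ` V t \<and> inj_on (\<phi> s) (V t)))"

text \<open>Since velocity and density are regular only almost everywhere, the transport formula
  cannot be derived for all regions (which may meet singularities of the flow).  It is part of
  what is required of a region, with a genuine time derivative on its left-hand side.\<close>

definition fluid_region ::
    "scalar_field \<Rightarrow> vector_field \<Rightarrow> (real \<Rightarrow> (real ^ 3) set) \<Rightarrow> real \<Rightarrow> bool" where
  "fluid_region \<rho>\<^sub>m w V t \<longleftrightarrow>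
     moves_with w V t \<and>
     (\<forall>\<^sub>F s in nhds t. V s \<in> sets lebesgue \<and>
        set_integrable lebesgue (V s) (\<lambda>x. \<rho>\<^sub>m s x *\<^sub>R w s x)) \<and>
     set_integrable lebesgue (V t) (momentum_transport \<rho>\<^sub>m w t) \<and>
     ((\<lambda>s. LINT x:V s|lebesgue. \<rho>\<^sub>m s x *\<^sub>R w s x) has_vector_derivative
        (LINT x:V t|lebesgue. momentum_transport \<rho>\<^sub>m w t x)) (at t)"

text \<open>The integral form of the equation that contains \<open>\<nabla>(P + p)\<close> carries no term
  \<open>\<eta>\<nabla>(\<nabla>\<cdot>v)\<close>, in contrast with the integral form of the equation for \<open>\<partial>w\<close>.  In fact, with
  \<open>w = u + v\<close> and the continuity equation,
  \<open>\<partial>(\<rho>\<^sub>mw) + \<rho>\<^sub>m(w\<cdot>\<nabla>)w + (\<nabla>\<cdot>(\<rho>\<^sub>mw))w - (\<nabla>\<cdot>(\<rho>\<^sub>mv))u - (\<nabla>\<cdot>(\<rho>\<^sub>mu))v - \<rho>\<^sub>m\<nabla>(u\<cdot>v)\<close>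
  is equal to
  \<open>\<partial>(\<rho>\<^sub>mu) + \<rho>\<^sub>m\<partial>v + \<onehalf>\<rho>\<^sub>m\<nabla>(|u|\<^sup>2 + |v|\<^sup>2) + (\<nabla>\<cdot>(\<rho>\<^sub>mu))u\<close>,
  so an additional source \<open>\<eta>\<nabla>(\<nabla>\<cdot>v)\<close> would be consistent only where \<open>\<nabla>(\<nabla>\<cdot>v) = 0\<close>.\<close>

end

(* Off a closed null set rho is positive and rho, S are C2; there u and v are the gradients of
   -zeta ln rho and S / m, and the continuity equation, whose terms are continuous, holds
   everywhere.  It then says that the time derivative of -zeta ln rho is
   zeta div v - u . v, whose gradient turns equation 1 into equation 2, and that p is
   zeta0 times the time derivative of rho, whose gradient turns equation 1 into equation 3.
   Since u + v is a gradient too, the momentum transport differs from the left-hand sides only by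
   the extra terms of the integral forms.

   To recover a pointwise equation from its integral form, let the particles of an arbitrary
   measurable set K in a small ball move along y + (s - t) w(t, y).  By change of variables and
   differentiation under the integral this is a fluid region, so the difference of both sides has
   zero integral over every such K on which it is bounded, hence vanishes almost everywhere;
   Tonelli then passes from almost all times to almost all space-time points. *)
theory Submission
  imports Defs
begin

subsection \<open>Functions of class C1 and C2\<close>

text \<open>The obstacle is regularity. The data are only C2, while \<open>grad P\<close>,
  \<open>grad p\<close> and \<open>grad (divg v)\<close> are formally of third order. For
  \<open>p\<close> and \<open>divg v\<close> the continuity equation helps: on the regular set each
  equals an expression in first derivatives of C2 functions, hence is C1 and has a continuous
  gradient. For \<open>P\<close> there is no such identity, so its differentiability almost
  everywhere is a hypothesis, and \<open>grad P\<close>, like \<open>grad U\<close>, is merely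
  Lebesgue measurable, as an almost everywhere limit of difference quotients. The source terms may
  therefore fail to be integrable over every ball. This dictates the test regions: subsets of the
  sublevel sets of the defect, which have no regular boundary, so the transport formula is proved
  for all measurable subsets of a small ball and not by a boundary flux argument. The deformation is
  free as long as its velocity at time \<open>t\<close> is right; the affine one makes the volume
  element a cubic polynomial in \<open>s - t\<close>.\<close>

definition C1_on :: "('a::real_normed_vector \<Rightarrow> 'b::real_normed_vector) \<Rightarrow> 'a set \<Rightarrow> bool" where
  "C1_on f W \<longleftrightarrow> (\<forall>z\<in>W. f differentiable at z) \<and>
     (\<forall>h. continuous_on W (\<lambda>z. frechet_derivative f (at z) h))"

text \<open>Continuity of derivatives is demanded for each fixed direction \<open>h\<close> rather
  than in an operator space. In finite dimension this is the same notion, and closure rules and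
  estimates then concern ordinary vector-valued functions.\<close>

definition twice_C1_on :: "('a::real_normed_vector \<Rightarrow> 'b::real_normed_vector) \<Rightarrow> 'a set \<Rightarrow> bool" where
  "twice_C1_on f W \<longleftrightarrow> C1_on f W \<and> (\<forall>h. C1_on (\<lambda>z. frechet_derivative f (at z) h) W)"

lemma C1_onI:
  assumes "\<And>z. z \<in> W \<Longrightarrow> (f has_derivative f' z) (at z)" "\<And>h. continuous_on W (\<lambda>z. f' z h)"
  shows "C1_on f W"
  unfolding C1_on_def
proof (intro conjI ballI allI)
  show "f differentiable at z" if "z \<in> W" for z
    using assms(1)[OF that] by (auto simp: differentiable_def)
  show "continuous_on W (\<lambda>z. frechet_derivative f (at z) h)" for h
    using assms(2)[of h] by (rule continuous_on_eq) (metis assms(1) frechet_derivative_at)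
qed

lemma C1_on_has_derivative:
  assumes "C1_on f W" "z \<in> W"
  shows "(f has_derivative frechet_derivative f (at z)) (at z)"
  using assms frechet_derivative_works unfolding C1_on_def by blast

lemma C1_on_continuous_deriv:
  "C1_on f W \<Longrightarrow> continuous_on W (\<lambda>z. frechet_derivative f (at z) h)"
  unfolding C1_on_def by blast

lemma C1_on_continuous: "C1_on f W \<Longrightarrow> continuous_on W f"
  by (meson C1_on_has_derivative continuous_at_imp_continuous_on has_derivative_continuous)

lemma has_derivative_cong_open:
  assumes "open W" "z \<in> W" "\<And>y. y \<in> W \<Longrightarrow> f y = g y" "(g has_derivative d) (at z)"
  shows "(f has_derivative d) (at z)"
  using has_derivative_transform_within_open[OF assms(4) assms(1,2)] assms(3) by simp

lemma frechet_derivative_cong_open: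
  assumes "open W" "z \<in> W" "\<And>y. y \<in> W \<Longrightarrow> f y = g y"
  shows "frechet_derivative f (at z) = frechet_derivative g (at z)"
proof -
  have "(f has_derivative d) (at z) \<longleftrightarrow> (g has_derivative d) (at z)" for d
    using has_derivative_cong_open[OF assms(1,2)] assms(3) by metis
  then show ?thesis unfolding frechet_derivative_def by simp
qed

lemma C1_on_cong:
  assumes "open W" "\<And>y. y \<in> W \<Longrightarrow> f y = g y" "C1_on g W"
  shows "C1_on f W"
proof (rule C1_onI)
  show "(f has_derivative frechet_derivative g (at z)) (at z)" if "z \<in> W" for z
    by (rule has_derivative_cong_open[OF assms(1) that assms(2) C1_on_has_derivative[OF assms(3) that]])
  show "continuous_on W (\<lambda>z. frechet_derivative g (at z) h)" for h
    using assms(3) by (rule C1_on_continuous_deriv)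
qed

lemma C1_on_const [intro]: "C1_on (\<lambda>z. c) W"
  by (rule C1_onI[where f' = "\<lambda>z h. 0"]) (auto intro!: derivative_eq_intros)

lemma C1_on_add [intro]:
  assumes "C1_on f W" "C1_on g W" shows "C1_on (\<lambda>z. f z + g z) W"
  by (rule C1_onI[OF has_derivative_add[OF C1_on_has_derivative[OF assms(1)] C1_on_has_derivative[OF assms(2)]]])
     (auto intro!: continuous_intros C1_on_continuous_deriv assms)

lemma C1_on_sum [intro]:
  assumes "\<And>i. i \<in> I \<Longrightarrow> C1_on (f i) W" shows "C1_on (\<lambda>z. \<Sum>i\<in>I. f i z) W"
  using assms by (induction I rule: infinite_finite_induct) auto

lemma C1_on_scaleR [intro]:
  assumes "C1_on f W" "C1_on g W" shows "C1_on (\<lambda>z. f z *\<^sub>R g z) W"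
  by (rule C1_onI[OF has_derivative_scaleR[OF C1_on_has_derivative[OF assms(1)] C1_on_has_derivative[OF assms(2)]]])
     (auto intro!: continuous_intros C1_on_continuous_deriv assms C1_on_continuous[OF assms(1)] C1_on_continuous[OF assms(2)])

lemma C1_on_inner [intro]:
  assumes "C1_on f W" "C1_on g W" shows "C1_on (\<lambda>z. f z \<bullet> g z) W"
  by (rule C1_onI[OF has_derivative_inner[OF C1_on_has_derivative[OF assms(1)] C1_on_has_derivative[OF assms(2)]]])
     (auto intro!: continuous_intros C1_on_continuous_deriv assms C1_on_continuous[OF assms(1)] C1_on_continuous[OF assms(2)])

lemma C1_on_inverse [intro]:
  fixes f :: "'a::real_normed_vector \<Rightarrow> real"
  assumes "C1_on f W" "\<And>z. z \<in> W \<Longrightarrow> f z \<noteq> 0" shows "C1_on (\<lambda>z. inverse (f z)) W"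
  by (rule C1_onI[OF Deriv.has_derivative_inverse[OF assms(2) C1_on_has_derivative[OF assms(1)]]])
     (auto intro!: continuous_intros C1_on_continuous_deriv assms C1_on_continuous[OF assms(1)])

lemma C1_on_ln:
  fixes f :: "'a::real_normed_vector \<Rightarrow> real"
  assumes "C1_on f W" "\<And>z. z \<in> W \<Longrightarrow> f z > 0" shows "C1_on (\<lambda>z. ln (f z)) W"
proof (rule C1_onI)
  show "((\<lambda>z. ln (f z)) has_derivative (\<lambda>h. frechet_derivative f (at z) h * inverse (f z))) (at z)" if "z \<in> W" for z
    using has_derivative_ln[OF assms(2)[OF that] C1_on_has_derivative[OF assms(1) that]] .
qed (use assms in \<open>auto intro!: continuous_intros C1_on_continuous_deriv C1_on_continuous[OF assms(1)] simp: less_imp_neq[symmetric]\<close>)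

lemma twice_C1_onI:
  assumes "open W" "\<And>z. z \<in> W \<Longrightarrow> (f has_derivative f' z) (at z)" "\<And>h. C1_on (\<lambda>z. f' z h) W"
  shows "twice_C1_on f W"
  unfolding twice_C1_on_def
proof (intro conjI allI)
  show "C1_on f W" using assms by (intro C1_onI[of W f f']) (auto intro: C1_on_continuous)
  show "C1_on (\<lambda>z. frechet_derivative f (at z) h) W" for h
    using assms(1) _ assms(3)[of h] by (rule C1_on_cong) (metis assms(2) frechet_derivative_at)
qed

lemma twice_C1_on_scaleR_add:
  fixes f g :: "'a::real_normed_vector \<Rightarrow> 'b::real_normed_vector"
  assumes "open W" "twice_C1_on f W" "twice_C1_on g W"
  shows "twice_C1_on (\<lambda>z. a *\<^sub>R f z + b *\<^sub>R g z) W"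
proof (rule twice_C1_onI[OF assms(1)])
  show "((\<lambda>z. a *\<^sub>R f z + b *\<^sub>R g z) has_derivative
      (\<lambda>h. a *\<^sub>R frechet_derivative f (at z) h + b *\<^sub>R frechet_derivative g (at z) h)) (at z)" if "z \<in> W" for z
    using assms that by (auto intro!: derivative_intros C1_on_has_derivative simp: twice_C1_on_def)
qed (use assms in \<open>auto intro!: C1_on_scaleR C1_on_add simp: twice_C1_on_def\<close>)

lemma twice_C1_on_scaleR:
  fixes f :: "'a::real_normed_vector \<Rightarrow> 'b::real_normed_vector"
  assumes "open W" "twice_C1_on f W"
  shows "twice_C1_on (\<lambda>z. a *\<^sub>R f z) W"
  using twice_C1_on_scaleR_add[OF assms(1,2,2), of a 0] by simp

lemma twice_C1_on_ln:
  fixes f :: "'a::real_normed_vector \<Rightarrow> real"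
  assumes "open W" "twice_C1_on f W" "\<And>z. z \<in> W \<Longrightarrow> f z > 0"
  shows "twice_C1_on (\<lambda>z. ln (f z)) W"
proof (rule twice_C1_onI[OF assms(1)])
  show "((\<lambda>z. ln (f z)) has_derivative (\<lambda>h. inverse (f z) *\<^sub>R frechet_derivative f (at z) h)) (at z)" if "z \<in> W" for z
    using has_derivative_ln[OF assms(3)[OF that] C1_on_has_derivative[of f W z]] assms(2) that
    by (simp add: twice_C1_on_def mult.commute)
  show "C1_on (\<lambda>z. inverse (f z) *\<^sub>R frechet_derivative f (at z) h) W" for h
    using assms unfolding twice_C1_on_def by (intro C1_on_scaleR C1_on_inverse) (auto simp: less_imp_neq[symmetric])
qed

text \<open>Evaluation at a fixed direction is bounded linear, so the operator-valued derivatives of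
  \<open>C2_on\<close> pass to directional ones.\<close>

lemma C2_on_imp_twice_C1_on:
  assumes "open W" "C2_on f W"
  shows "twice_C1_on f W"
proof -
  obtain f' f'' where f: "\<And>z. z \<in> W \<Longrightarrow> (f has_derivative blinfun_apply (f' z)) (at z)"
    "\<And>z. z \<in> W \<Longrightarrow> (f' has_derivative blinfun_apply (f'' z)) (at z)" "continuous_on W f''"
    using assms(2) unfolding C2_on_def by blast
  show ?thesis
  proof (rule twice_C1_onI[OF assms(1) f(1)])
    show "C1_on (\<lambda>z. blinfun_apply (f' z) h) W" for h
    proof (rule C1_onI)
      show "((\<lambda>z. blinfun_apply (f' z) h) has_derivative (\<lambda>k. blinfun_apply (blinfun_apply (f'' z) k) h)) (at z)"
        if "z \<in> W" for z
        by (rule bounded_linear.has_derivative[OF blinfun.bounded_linear_left f(2)[OF that]])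
      show "continuous_on W (\<lambda>z. blinfun_apply (blinfun_apply (f'' z) k) h)" for k
        by (intro continuous_intros f(3))
    qed
  qed
qed

text \<open>\<open>C2_ae\<close> supplies a separate neighbourhood with its own witnesses for each
  point. Since \<open>frechet_derivative\<close> is canonical, nothing has to be glued:
  differentiability and continuity are checked point by point.\<close>

lemma twice_C1_on_local:
  assumes "\<And>z. z \<in> G \<Longrightarrow> \<exists>W. open W \<and> z \<in> W \<and> twice_C1_on f W"
  shows "twice_C1_on f G"
proof -
  have loc: "C1_on g G" if g: "\<And>z. z \<in> G \<Longrightarrow> \<exists>W. open W \<and> z \<in> W \<and> C1_on g W" for g :: "'a \<Rightarrow> 'b"
    unfolding C1_on_def
  proof (intro conjI ballI allI)
    show "g differentiable at z" if "z \<in> G" for z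
      using g[OF that] by (auto simp: C1_on_def)
    show "continuous_on G (\<lambda>z. frechet_derivative g (at z) h)" for h
      by (rule continuous_at_imp_continuous_on)
        (metis g C1_on_continuous_deriv continuous_on_eq_continuous_at)
  qed
  show ?thesis
    unfolding twice_C1_on_def
    by (intro conjI allI; rule loc; insert assms; unfold twice_C1_on_def; blast)
qed

subsection \<open>Symmetry of second derivatives\<close>

text \<open>Two applications of the mean value theorem: one to the increment in direction
  \<open>k\<close> as a function of the position along \<open>h\<close>, one to the resulting
  increment of the directional derivative along \<open>k\<close>. The quotient is exactly a second
  derivative at an intermediate point, so continuity gives the limit.\<close>

lemma second_difference_tendsto:
  fixes f :: "'a::real_normed_vector \<Rightarrow> real"
  assumes W: "open W" "z \<in> W" and f: "twice_C1_on f W"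
  shows "((\<lambda>s. (f (z + s *\<^sub>R h + s *\<^sub>R k) - f (z + s *\<^sub>R h) - f (z + s *\<^sub>R k) + f z) / s\<^sup>2) \<longlongrightarrow>
    frechet_derivative (\<lambda>y. frechet_derivative f (at y) h) (at z) k) (at_right 0)"
proof (rule tendstoI)
  let ?D = "\<lambda>y. frechet_derivative f (at y) h"
  let ?E = "\<lambda>y. frechet_derivative ?D (at y) k"
  fix e :: real assume "e > 0"
  have C: "C1_on f W" "C1_on ?D W" using f by (auto simp: twice_C1_on_def)
  have "continuous_on W ?E" using C(2) by (rule C1_on_continuous_deriv)
  then have "isCont ?E z" using W continuous_on_eq_continuous_at by blast
  then obtain d0 where d0: "d0 > 0" "\<And>y. dist y z < d0 \<Longrightarrow> dist (?E y) (?E z) < e"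
    using \<open>e > 0\<close> unfolding continuous_at_eps_delta by blast
  obtain d1 where d1: "d1 > 0" "ball z d1 \<subseteq> W" using W openE by blast
  define d where "d = min d0 d1"
  have "d > 0" using d0 d1 by (simp add: d_def)
  \<comment> \<open>For steps below \<open>r\<close> the whole parallelogram spanned by the scaled
    \<open>h\<close> and \<open>k\<close> stays within distance \<open>d\<close> of
    \<open>z\<close>; the 1 keeps the denominator positive.\<close>
  define r where "r = d / (norm h + norm k + 1)"
  have "r > 0" using \<open>d > 0\<close> by (simp add: r_def add_nonneg_pos)
  have near: "dist (z + a *\<^sub>R h + b *\<^sub>R k) z < d" if "0 \<le> a" "a \<le> s" "0 \<le> b" "b \<le> s" "s < r" for a b s
  proof -
    have "dist (z + a *\<^sub>R h + b *\<^sub>R k) z \<le> a * norm h + b * norm k"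
      using norm_triangle_ineq[of "a *\<^sub>R h" "b *\<^sub>R k"] that by (simp add: dist_norm add.assoc)
    also have "\<dots> \<le> s * norm h + s * norm k"
      using that by (intro add_mono mult_right_mono) auto
    also have "\<dots> \<le> s * (norm h + norm k + 1)" using that by (simp add: algebra_simps)
    also have "\<dots> < d" using that(5) unfolding r_def
      by (smt (verit) norm_ge_zero pos_less_divide_eq)
    finally show ?thesis .
  qed
  have inW: "z + a *\<^sub>R h + b *\<^sub>R k \<in> W" if "0 \<le> a" "a \<le> s" "0 \<le> b" "b \<le> s" "s < r" for a b s
    using near[OF that] d1(2) by (auto simp: d_def dist_commute)
  have main: "dist ((f (z + s *\<^sub>R h + s *\<^sub>R k) - f (z + s *\<^sub>R h) - f (z + s *\<^sub>R k) + f z) / s\<^sup>2) (?E z) < e"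
    if s: "0 < s" "s < r" for s
  proof -
    have der1: "((\<lambda>a. f (y + a *\<^sub>R h)) has_real_derivative ?D (y + a *\<^sub>R h)) (at a)"
      if "y + a *\<^sub>R h \<in> W" for a y
    proof -
      have "((\<lambda>a. f (y + a *\<^sub>R h)) has_derivative (\<lambda>x. frechet_derivative f (at (y + a *\<^sub>R h)) (x *\<^sub>R h))) (at a)"
        by (rule has_derivative_compose[where f = "\<lambda>a. y + a *\<^sub>R h" and g = f, OF _ C1_on_has_derivative[OF C(1) that]])
           (auto intro!: derivative_eq_intros)
      moreover have "frechet_derivative f (at (y + a *\<^sub>R h)) (x *\<^sub>R h) = ?D (y + a *\<^sub>R h) * x" for x
        using linear_scale[OF has_derivative_linear[OF C1_on_has_derivative[OF C(1) that]]] by simp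
      ultimately show ?thesis by (simp add: has_field_derivative_def)
    qed
    have "\<exists>a>0. a < s \<and> (f (z + s *\<^sub>R h + s *\<^sub>R k) - f (z + s *\<^sub>R h)) - (f (z + 0 *\<^sub>R h + s *\<^sub>R k) - f (z + 0 *\<^sub>R h))
       = (s - 0) * (?D (z + a *\<^sub>R h + s *\<^sub>R k) - ?D (z + a *\<^sub>R h))"
    proof (rule MVT2[OF s(1)])
      fix a assume a: "0 \<le> a" "a \<le> s"
      have "((\<lambda>a. f (z + s *\<^sub>R k + a *\<^sub>R h)) has_real_derivative ?D (z + s *\<^sub>R k + a *\<^sub>R h)) (at a)"
        using inW[OF a _ _ s(2), of s] s by (intro der1) (simp add: ac_simps)
      moreover have "((\<lambda>a. f (z + a *\<^sub>R h)) has_real_derivative ?D (z + a *\<^sub>R h)) (at a)"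
        using inW[OF a _ _ s(2), of 0] s by (intro der1) simp
      ultimately show "((\<lambda>a. f (z + a *\<^sub>R h + s *\<^sub>R k) - f (z + a *\<^sub>R h)) has_real_derivative
          ?D (z + a *\<^sub>R h + s *\<^sub>R k) - ?D (z + a *\<^sub>R h)) (at a)"
        by (auto intro!: derivative_eq_intros simp: ac_simps)
    qed
    then obtain a where a: "a > 0" "a < s" and ea: "f (z + s *\<^sub>R h + s *\<^sub>R k) - f (z + s *\<^sub>R h) - f (z + s *\<^sub>R k) + f z
       = s * (?D (z + a *\<^sub>R h + s *\<^sub>R k) - ?D (z + a *\<^sub>R h))" by auto
    have "\<exists>b>0. b < s \<and> ?D (z + a *\<^sub>R h + s *\<^sub>R k) - ?D (z + a *\<^sub>R h + 0 *\<^sub>R k) = (s - 0) * ?E (z + a *\<^sub>R h + b *\<^sub>R k)"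
    proof (rule MVT2[OF s(1)])
      fix b assume b: "0 \<le> b" "b \<le> s"
      have y: "z + a *\<^sub>R h + b *\<^sub>R k \<in> W" using inW[OF _ _ b s(2), of a] a by simp
      have "((\<lambda>b. ?D (z + a *\<^sub>R h + b *\<^sub>R k)) has_derivative
          (\<lambda>x. frechet_derivative ?D (at (z + a *\<^sub>R h + b *\<^sub>R k)) (x *\<^sub>R k))) (at b)"
        by (rule has_derivative_compose[where f = "\<lambda>b. z + a *\<^sub>R h + b *\<^sub>R k" and g = ?D, OF _ C1_on_has_derivative[OF C(2) y]])
           (auto intro!: derivative_eq_intros)
      moreover have "frechet_derivative ?D (at (z + a *\<^sub>R h + b *\<^sub>R k)) (x *\<^sub>R k) = ?E (z + a *\<^sub>R h + b *\<^sub>R k) * x" for x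
        using linear_scale[OF has_derivative_linear[OF C1_on_has_derivative[OF C(2) y]]] by simp
      ultimately show "((\<lambda>b. ?D (z + a *\<^sub>R h + b *\<^sub>R k)) has_real_derivative ?E (z + a *\<^sub>R h + b *\<^sub>R k)) (at b)"
        by (simp add: has_field_derivative_def)
    qed
    then obtain b where b: "b > 0" "b < s" and eb: "?D (z + a *\<^sub>R h + s *\<^sub>R k) - ?D (z + a *\<^sub>R h) = s * ?E (z + a *\<^sub>R h + b *\<^sub>R k)"
      by auto
    have "(f (z + s *\<^sub>R h + s *\<^sub>R k) - f (z + s *\<^sub>R h) - f (z + s *\<^sub>R k) + f z) / s\<^sup>2 = ?E (z + a *\<^sub>R h + b *\<^sub>R k)"
      unfolding ea eb using s by (simp add: power2_eq_square)
    then show ?thesis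
      using d0(2)[of "z + a *\<^sub>R h + b *\<^sub>R k"] near[of a s b] a b s by (simp add: d_def)
  qed
  show "\<forall>\<^sub>F s in at_right 0. dist ((f (z + s *\<^sub>R h + s *\<^sub>R k) - f (z + s *\<^sub>R h) - f (z + s *\<^sub>R k) + f z) / s\<^sup>2) (?E z) < e"
    unfolding eventually_at_right_field using \<open>r > 0\<close> main by (intro exI[of _ r]) auto
qed

text \<open>The second difference quotient is symmetric in \<open>h\<close> and \<open>k\<close>, so
  the limits obtained from the two orders coincide.\<close>

lemma frechet_derivative_symmetric:
  fixes f :: "'a::real_normed_vector \<Rightarrow> real"
  assumes "open W" "z \<in> W" "twice_C1_on f W"
  shows "frechet_derivative (\<lambda>y. frechet_derivative f (at y) h) (at z) k
       = frechet_derivative (\<lambda>y. frechet_derivative f (at y) k) (at z) h"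
proof (rule tendsto_unique[OF _ second_difference_tendsto[OF assms, of h k]])
  have "(\<lambda>s. (f (z + s *\<^sub>R h + s *\<^sub>R k) - f (z + s *\<^sub>R h) - f (z + s *\<^sub>R k) + f z) / s\<^sup>2)
     = (\<lambda>s. (f (z + s *\<^sub>R k + s *\<^sub>R h) - f (z + s *\<^sub>R k) - f (z + s *\<^sub>R h) + f z) / s\<^sup>2)"
    by (rule ext) (simp add: algebra_simps)
  then show "((\<lambda>s. (f (z + s *\<^sub>R h + s *\<^sub>R k) - f (z + s *\<^sub>R h) - f (z + s *\<^sub>R k) + f z) / s\<^sup>2) \<longlongrightarrow>
     frechet_derivative (\<lambda>y. frechet_derivative f (at y) k) (at z) h) (at_right 0)"
    using second_difference_tendsto[OF assms, of k h] by simp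
qed simp

subsection \<open>Differential operators on space-time fields\<close>

lemma spatial_has_derivative:
  assumes "(case_prod f has_derivative d) (at (t, x))"
  shows "(f t has_derivative (\<lambda>h. d (0, h))) (at x)"
proof -
  have "((\<lambda>y. case_prod f (t, y)) has_derivative (\<lambda>h. d (0, h))) (at x)"
    by (rule has_derivative_compose[where f = "\<lambda>y. (t, y)", OF _ assms]) (auto intro!: derivative_eq_intros)
  then show ?thesis by simp
qed

lemma temporal_has_vector_derivative:
  assumes "(case_prod f has_derivative d) (at (t, x))"
  shows "((\<lambda>s. f s x) has_vector_derivative d (1, 0)) (at t)"
proof -
  have "((\<lambda>s. case_prod f (s, x)) has_derivative (\<lambda>h. d (h, 0))) (at t)"
    by (rule has_derivative_compose[where f = "\<lambda>s. (s, x)", OF _ assms]) (auto intro!: derivative_eq_intros)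
  moreover have "(\<lambda>h. d (h, 0)) = (\<lambda>h. h *\<^sub>R d (1, 0))"
  proof
    fix h
    have "d (h, 0) = d (h *\<^sub>R (1, 0))" by simp
    then show "d (h, 0) = h *\<^sub>R d (1, 0)" using linear_scale[OF has_derivative_linear[OF assms]] by metis
  qed
  ultimately show ?thesis by (simp add: has_vector_derivative_def)
qed

lemma time_deriv_eq:
  assumes "(case_prod f has_derivative d) (at (t, x))"
  shows "time_deriv f t x = d (1, 0)"
  unfolding time_deriv_def by (rule vector_derivative_at[OF temporal_has_vector_derivative[OF assms]])

lemma has_derivative_eq_inner:
  fixes f :: "real ^ 'n \<Rightarrow> real"
  assumes "(f has_derivative d) (at x)"
  shows "d = (\<lambda>h. h \<bullet> (\<chi> i. d (axis i 1)))"
proof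
  fix h :: "real ^ 'n"
  have "h = (\<Sum>i\<in>UNIV. h $ i *\<^sub>R axis i 1)"
    by (simp add: vec_eq_iff axis_def if_distrib cong: if_cong)
  then have "d h = d (\<Sum>i\<in>UNIV. h $ i *\<^sub>R axis i 1)" by simp
  also have "\<dots> = (\<Sum>i\<in>UNIV. h $ i * d (axis i 1))"
    by (simp add: linear_sum[OF has_derivative_linear[OF assms]] linear_scale[OF has_derivative_linear[OF assms]])
  finally show "d h = h \<bullet> (\<chi> i. d (axis i 1))" by (simp add: inner_vec_def)
qed

text \<open>\<open>grad\<close> is a definite description, so uniqueness of the vector representing
  the derivative is part of the argument.\<close>

lemma grad_eq:
  assumes "(f t has_derivative d) (at x)"
  shows "grad f t x = (\<chi> i. d (axis i 1))"
  unfolding grad_def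
proof (rule the_equality)
  show "GDERIV (f t) x :> (\<chi> i. d (axis i 1))"
    unfolding gderiv_def using assms has_derivative_eq_inner[OF assms] by simp
  fix g assume "GDERIV (f t) x :> g"
  then have "d = (\<lambda>h. h \<bullet> g)"
    unfolding gderiv_def using assms has_derivative_unique by blast
  then show "g = (\<chi> i. d (axis i 1))" by (simp add: vec_eq_iff inner_axis')
qed

lemma grad_inner:
  assumes "(f t has_derivative d) (at x)"
  shows "h \<bullet> grad f t x = d h"
  using has_derivative_eq_inner[OF assms] grad_eq[of f t, OF assms] by metis

lemma divg_eq:
  assumes "(F t has_derivative d) (at x)"
  shows "divg F t x = (\<Sum>i\<in>UNIV. d (axis i 1) $ i)"
  unfolding divg_def trace_def jacobian_def frechet_derivative_at[OF assms, symmetric]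
  by (simp add: matrix_def)

lemma convect_eq:
  assumes "(F t has_derivative d) (at x)"
  shows "convect a F t x = d (a t x)"
  unfolding convect_def frechet_derivative_at[OF assms, symmetric] ..

section \<open>Locality of the differential operators\<close>

lemma slice_open:
  fixes G :: "('a::topological_space \<times> 'b::topological_space) set"
  assumes "open G" shows "open {x. (t, x) \<in> G}" "open {s. (s, x) \<in> G}"
  using open_vimage[OF assms, of "\<lambda>x. (t, x)"] open_vimage[OF assms, of "\<lambda>s. (s, x)"]
  by (simp_all add: vimage_def continuous_intros)

text \<open>Identities such as \<open>u = grad \<Phi>\<close> will hold only on an open subset of
  space-time. The operators depend on germs only, so such identities may be differentiated
  there.\<close>

lemma grad_cong:
  assumes "open G" "(t, x) \<in> G" "\<And>s y. (s, y) \<in> G \<Longrightarrow> f s y = g s y"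
  shows "grad f t x = grad g t x"
proof -
  have "(f t has_derivative d) (at x) \<longleftrightarrow> (g t has_derivative d) (at x)" for d
    using has_derivative_cong_open[OF slice_open(1)[OF assms(1), of t], of x "f t" "g t" d]
      has_derivative_cong_open[OF slice_open(1)[OF assms(1), of t], of x "g t" "f t" d]
      assms(2,3) by auto
  then show ?thesis unfolding grad_def gderiv_def by simp
qed

lemma frechet_derivative_slice_cong:
  assumes "open G" "(t, x) \<in> G" "\<And>s y. (s, y) \<in> G \<Longrightarrow> f s y = g s y"
  shows "frechet_derivative (f t) (at x) = frechet_derivative (g t) (at x)"
  by (rule frechet_derivative_cong_open[OF slice_open(1)[OF assms(1), of t]]) (use assms in auto)

lemma convect_cong:
  assumes "open G" "(t, x) \<in> G" "\<And>s y. (s, y) \<in> G \<Longrightarrow> f s y = g s y"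
  shows "convect f f t x = convect g g t x"
  using frechet_derivative_slice_cong[of G t x f g, OF assms] assms(2,3) by (simp add: convect_def)

lemma time_deriv_cong:
  assumes "open G" "(t, x) \<in> G" "\<And>s y. (s, y) \<in> G \<Longrightarrow> f s y = g s y"
  shows "time_deriv f t x = time_deriv g t x"
proof -
  have "((\<lambda>s. f s x) has_derivative d) (at t) \<longleftrightarrow> ((\<lambda>s. g s x) has_derivative d) (at t)" for d
    using has_derivative_cong_open[OF slice_open(2)[OF assms(1), of x], of t "\<lambda>s. f s x" "\<lambda>s. g s x" d]
      has_derivative_cong_open[OF slice_open(2)[OF assms(1), of x], of t "\<lambda>s. g s x" "\<lambda>s. f s x" d]
      assms(2,3) by auto
  then show ?thesis unfolding time_deriv_def vector_derivative_def has_vector_derivative_def by simp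
qed

lemma
  assumes "C1_on (case_prod f) G" "(t, x) \<in> G"
  shows C1_field_spatial: "(f t has_derivative (\<lambda>h. frechet_derivative (case_prod f) (at (t, x)) (0, h))) (at x)"
    and C1_field_differentiable: "f t differentiable at x"
    and C1_field_temporal: "((\<lambda>s. f s x) has_vector_derivative time_deriv f t x) (at t)"
    and C1_field_time_deriv: "time_deriv f t x = frechet_derivative (case_prod f) (at (t, x)) (1, 0)"
proof -
  note d = C1_on_has_derivative[OF assms]
  show "(f t has_derivative (\<lambda>h. frechet_derivative (case_prod f) (at (t, x)) (0, h))) (at x)"
    using d by (rule spatial_has_derivative)
  then show "f t differentiable at x" by (auto simp: differentiable_def)
  show "time_deriv f t x = frechet_derivative (case_prod f) (at (t, x)) (1, 0)"
    using d by (rule time_deriv_eq)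
  with temporal_has_vector_derivative[OF d]
  show "((\<lambda>s. f s x) has_vector_derivative time_deriv f t x) (at t)" by simp
qed

section \<open>Regularity of derived fields and commuting derivatives\<close>

lemma continuous_on_cong_case_prod:
  assumes "\<And>t x. (t, x) \<in> G \<Longrightarrow> f t x = g (t, x)" "continuous_on G g"
  shows "continuous_on G (case_prod f)"
  using assms(2) by (rule continuous_on_eq) (use assms(1) in auto)

lemma continuous_on_time_deriv:
  assumes "C1_on (case_prod f) G" shows "continuous_on G (case_prod (time_deriv f))"
  by (rule continuous_on_cong_case_prod[OF _ C1_on_continuous_deriv[OF assms]])
     (rule C1_field_time_deriv[OF assms])

lemma continuous_on_grad:
  assumes "C1_on (case_prod f) G" shows "continuous_on G (case_prod (grad f))"
  by (rule continuous_on_cong_case_prod[where g = "\<lambda>z. \<chi> i. frechet_derivative (case_prod f) (at z) (0, axis i 1)"])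
     (auto intro!: continuous_on_vec_lambda C1_on_continuous_deriv[OF assms] grad_eq C1_field_spatial[OF assms])

lemma continuous_on_divg:
  assumes "C1_on (case_prod F) G" shows "continuous_on G (case_prod (divg F))"
  by (rule continuous_on_cong_case_prod[where
        g = "\<lambda>z. \<Sum>i\<in>UNIV. frechet_derivative (case_prod F) (at z) (0, axis i 1) $ i"])
     (auto intro!: continuous_intros C1_on_continuous_deriv[OF assms] divg_eq C1_field_spatial[OF assms])

lemma C1_on_grad:
  assumes "open G" "twice_C1_on (case_prod f) G"
  shows "C1_on (case_prod (grad f)) G"
proof (rule C1_on_cong[OF assms(1)])
  have C: "C1_on (case_prod f) G" "\<And>h. C1_on (\<lambda>z. frechet_derivative (case_prod f) (at z) h) G"
    using assms(2) by (auto simp: twice_C1_on_def)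
  show "C1_on (\<lambda>z. \<Sum>i\<in>UNIV. frechet_derivative (case_prod f) (at z) (0, axis i 1) *\<^sub>R axis i 1) G"
    by (intro C1_on_sum C1_on_scaleR C C1_on_const)
  fix z assume "z \<in> G"
  then obtain t x where z: "z = (t, x)" "(t, x) \<in> G" by (cases z) auto
  show "case_prod (grad f) z = (\<Sum>i\<in>UNIV. frechet_derivative (case_prod f) (at z) (0, axis i 1) *\<^sub>R axis i 1)"
    unfolding z(1) using grad_eq[of f t, OF C1_field_spatial[OF C(1) z(2)]]
    by (simp add: vec_eq_iff axis_def if_distrib cong: if_cong)
qed

lemma C1_on_time_deriv:
  assumes "open G" "twice_C1_on (case_prod f) G"
  shows "C1_on (case_prod (time_deriv f)) G"
proof (rule C1_on_cong[OF assms(1)])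
  have C: "C1_on (case_prod f) G" using assms(2) by (auto simp: twice_C1_on_def)
  show "C1_on (\<lambda>z. frechet_derivative (case_prod f) (at z) (1, 0)) G"
    using assms(2) by (auto simp: twice_C1_on_def)
  show "case_prod (time_deriv f) z = frechet_derivative (case_prod f) (at z) (1, 0)" if "z \<in> G" for z
    using C1_field_time_deriv[OF C] that by (cases z) auto
qed

text \<open>Entries of the derivative of a gradient become iterated directional derivatives of
  \<open>f\<close>, the form to which symmetry of second derivatives applies.\<close>

lemma frechet_derivative_grad:
  assumes "open G" "twice_C1_on (case_prod f) G" "z \<in> G"
  shows "frechet_derivative (case_prod (grad f)) (at z) h $ i =
    frechet_derivative (\<lambda>y. frechet_derivative (case_prod f) (at y) (0, axis i 1)) (at z) h"
proof -
  have C: "C1_on (case_prod f) G" using assms(2) by (auto simp: twice_C1_on_def)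
  have "((\<lambda>y. case_prod (grad f) y $ i) has_derivative
      (\<lambda>h. frechet_derivative (case_prod (grad f)) (at z) h $ i)) (at z)"
    by (rule bounded_linear.has_derivative[OF bounded_linear_vec_nth C1_on_has_derivative[OF C1_on_grad[OF assms(1,2)] assms(3)]])
  then have "frechet_derivative (\<lambda>y. case_prod (grad f) y $ i) (at z) h = frechet_derivative (case_prod (grad f)) (at z) h $ i"
    by (metis frechet_derivative_at)
  moreover have "frechet_derivative (\<lambda>y. case_prod (grad f) y $ i) (at z)
     = frechet_derivative (\<lambda>y. frechet_derivative (case_prod f) (at y) (0, axis i 1)) (at z)"
    by (rule frechet_derivative_cong_open[OF assms(1,3)]) (auto simp: grad_eq[of f, OF C1_field_spatial[OF C]])
  ultimately show ?thesis by simp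
qed

text \<open>Symmetry of second derivatives for the directions \<open>(1, 0)\<close> and
  \<open>(0, axis i 1)\<close>.\<close>

lemma time_deriv_grad:
  assumes "open G" "twice_C1_on (case_prod f) G" "(t, x) \<in> G"
  shows "time_deriv (grad f) t x = grad (time_deriv f) t x"
proof -
  have C: "C1_on (case_prod f) G" using assms(2) by (auto simp: twice_C1_on_def)
  have "frechet_derivative (case_prod (time_deriv f)) (at (t, x))
     = frechet_derivative (\<lambda>y. frechet_derivative (case_prod f) (at y) (1, 0)) (at (t, x))"
    by (rule frechet_derivative_cong_open[OF assms(1,3)]) (auto simp: C1_field_time_deriv[OF C])
  then show ?thesis
    unfolding C1_field_time_deriv[OF C1_on_grad[OF assms(1,2)] assms(3)]
      grad_eq[of "time_deriv f" t, OF C1_field_spatial[OF C1_on_time_deriv[OF assms(1,2)] assms(3)]]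
    by (simp add: vec_eq_iff frechet_derivative_grad[OF assms] frechet_derivative_symmetric[OF assms(1,3,2)])
qed

text \<open>The Jacobian of a gradient is symmetric, so applying it to the field gives the same
  vector as applying its transpose, and the latter is half the gradient of the squared norm.\<close>

lemma convect_grad:
  assumes "open G" "twice_C1_on (case_prod f) G" "(t, x) \<in> G"
  shows "convect (grad f) (grad f) t x = (1 / 2) *\<^sub>R grad (\<lambda>s y. (norm (grad f s y))\<^sup>2) t x"
proof -
  let ?d = "\<lambda>h. frechet_derivative (case_prod (grad f)) (at (t, x)) (0, h)"
  have d: "(grad f t has_derivative ?d) (at x)"
    by (rule C1_field_spatial[OF C1_on_grad[OF assms(1,2)] assms(3)])
  have "((\<lambda>y. (norm (grad f t y))\<^sup>2) has_derivative (\<lambda>h. 2 * (grad f t x \<bullet> ?d h))) (at x)"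
    unfolding power2_norm_eq_inner by (auto intro!: derivative_eq_intros d simp: inner_commute)
  then have "grad (\<lambda>s y. (norm (grad f s y))\<^sup>2) t x = (\<chi> i. 2 * (grad f t x \<bullet> ?d (axis i 1)))"
    by (rule grad_eq)
  moreover have "grad f t x \<bullet> ?d (axis i 1) = ?d (grad f t x) $ i" for i
  proof -
    have sym: "?d (axis i 1) $ j = ?d (axis j 1) $ i" for j
      unfolding frechet_derivative_grad[OF assms] by (rule frechet_derivative_symmetric[OF assms(1,3,2)])
    have "((\<lambda>y. grad f t y $ i) has_derivative (\<lambda>h. ?d h $ i)) (at x)"
      by (rule bounded_linear.has_derivative[OF bounded_linear_vec_nth d])
    then have "(\<lambda>h. ?d h $ i) = (\<lambda>h. h \<bullet> (\<chi> j. ?d (axis j 1) $ i))"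
      by (rule has_derivative_eq_inner)
    then have "?d (grad f t x) $ i = grad f t x \<bullet> (\<chi> j. ?d (axis j 1) $ i)"
      by (rule fun_cong)
    then show ?thesis by (simp add: inner_vec_def sym)
  qed
  ultimately show ?thesis unfolding convect_eq[of "grad f" t, OF d] by (simp add: vec_eq_iff)
qed

section \<open>Sum and product rules\<close>

lemma grad_add:
  assumes "f t differentiable at x" "g t differentiable at x"
  shows "grad (\<lambda>s y. f s y + g s y) t x = grad f t x + grad g t x"
proof -
  note d = assms[unfolded frechet_derivative_works]
  show ?thesis unfolding grad_eq[of f t, OF d(1)] grad_eq[of g t, OF d(2)]
    by (subst grad_eq[of "\<lambda>s y. f s y + g s y" t, OF has_derivative_add[OF d]]) (simp add: vec_eq_iff)
qed

lemma grad_scaleR: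
  assumes "f t differentiable at x"
  shows "grad (\<lambda>s y. c * f s y) t x = c *\<^sub>R grad f t x"
proof -
  note d = assms[unfolded frechet_derivative_works]
  show ?thesis unfolding grad_eq[of f t, OF d(1)]
    by (subst grad_eq[of "\<lambda>s y. c * f s y" t, OF has_derivative_mult_right[OF d]]) (simp add: vec_eq_iff)
qed

lemma divg_add:
  assumes "f t differentiable at x" "g t differentiable at x"
  shows "divg (\<lambda>s y. f s y + g s y) t x = divg f t x + divg g t x"
proof -
  note d = assms[unfolded frechet_derivative_works]
  show ?thesis unfolding divg_eq[of f t, OF d(1)] divg_eq[of g t, OF d(2)]
    by (subst divg_eq[of "\<lambda>s y. f s y + g s y" t, OF has_derivative_add[OF d]]) (simp add: sum.distrib)
qed

lemma divg_scaleR: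
  assumes "f t differentiable at x" "g t differentiable at x"
  shows "divg (\<lambda>s y. f s y *\<^sub>R g s y) t x = f t x * divg g t x + g t x \<bullet> grad f t x"
proof -
  note d = assms[unfolded frechet_derivative_works]
  show ?thesis unfolding divg_eq[of g t, OF d(2)] grad_eq[of f t, OF d(1)]
    by (subst divg_eq[of "\<lambda>s y. f s y *\<^sub>R g s y" t, OF has_derivative_scaleR[OF d]])
       (simp add: sum.distrib inner_vec_def sum_distrib_left mult.commute)
qed

lemma time_deriv_scaleR:
  assumes "C1_on (case_prod f) G" "C1_on (case_prod g) G" "(t, x) \<in> G"
  shows "time_deriv (\<lambda>s y. f s y *\<^sub>R g s y) t x = f t x *\<^sub>R time_deriv g t x + time_deriv f t x *\<^sub>R g t x"
proof -
  have f: "((\<lambda>s. f s x) has_real_derivative time_deriv f t x) (at t)"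
    using C1_field_temporal[OF assms(1,3)] by (simp add: has_real_derivative_iff_has_vector_derivative)
  show ?thesis
    unfolding time_deriv_def[of "\<lambda>s y. f s y *\<^sub>R g s y"]
    by (rule vector_derivative_at[OF has_vector_derivative_scaleR[OF f C1_field_temporal[OF assms(2,3)]]])
qed

lemma time_deriv_add:
  assumes "C1_on (case_prod f) G" "C1_on (case_prod g) G" "(t, x) \<in> G"
  shows "time_deriv (\<lambda>s y. f s y + g s y) t x = time_deriv f t x + time_deriv g t x"
  unfolding time_deriv_def[of "\<lambda>s y. f s y + g s y"]
  by (rule vector_derivative_at[OF has_vector_derivative_add[OF C1_field_temporal[OF assms(1,3)] C1_field_temporal[OF assms(2,3)]]])

subsection \<open>Transport of small regions\<close>

text \<open>The coefficients are the trace, the sum of the principal 2 by 2 minors and the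
  determinant. With \<open>A\<close> the Jacobian of the velocity this is the volume element after
  time \<open>h\<close>, and its linear coefficient is the divergence.\<close>

lemma det_mat_1_plus_scaleR:
  fixes A :: "real ^ 3 ^ 3"
  shows "det (mat 1 + h *\<^sub>R A) = 1 + h * trace A
    + h\<^sup>2 * (A$1$1 * A$2$2 + A$1$1 * A$3$3 + A$2$2 * A$3$3 - A$1$2 * A$2$1 - A$1$3 * A$3$1 - A$2$3 * A$3$2)
    + h^3 * det A"
  by (simp add: det_3 trace_def sum_3 mat_def) (simp add: algebra_simps power2_eq_square power3_eq_cube)

lemma continuous_on_compact_norm_bound:
  fixes f :: "'a::topological_space \<Rightarrow> 'b::real_normed_vector"
  assumes "continuous_on K f" "compact K"
  shows "\<exists>B\<ge>0. \<forall>x\<in>K. norm (f x) \<le> B"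
proof -
  obtain B where B: "\<forall>x\<in>K. norm (f x) \<le> B"
    using compact_imp_bounded[OF compact_continuous_image[OF assms]] unfolding bounded_iff by auto
  show ?thesis by (rule exI[of _ "\<bar>B\<bar>"]) (use B in fastforce)
qed

text \<open>Continuity is available for one direction at a time. Compactness bounds the finitely
  many basis directions, and linearity adds these bounds up with the common factor
  \<open>norm h\<close>.\<close>

lemma C1_on_deriv_bound:
  fixes f :: "'a::euclidean_space \<Rightarrow> 'b::real_normed_vector"
  assumes "C1_on f W" "compact K" "K \<subseteq> W"
  shows "\<exists>L\<ge>0. \<forall>z\<in>K. \<forall>h. norm (frechet_derivative f (at z) h) \<le> L * norm h"
proof -
  let ?D = "\<lambda>z. frechet_derivative f (at z)"
  have "\<exists>c. \<forall>z\<in>K. norm (?D z b) \<le> c" for b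
    using continuous_on_compact_norm_bound[OF continuous_on_subset[OF C1_on_continuous_deriv[OF assms(1)] assms(3)] assms(2)]
    by blast
  then obtain c where c: "\<And>b z. z \<in> K \<Longrightarrow> norm (?D z b) \<le> c b" by metis
  have "norm (?D z h) \<le> (\<Sum>b\<in>Basis. \<bar>c b\<bar>) * norm h" if z: "z \<in> K" for z h
  proof -
    have lin: "linear (?D z)"
      using has_derivative_linear[OF C1_on_has_derivative[OF assms(1)]] z assms(3) by blast
    have "?D z h = ?D z (\<Sum>b\<in>Basis. (h \<bullet> b) *\<^sub>R b)" by (simp add: euclidean_representation)
    also have "\<dots> = (\<Sum>b\<in>Basis. (h \<bullet> b) *\<^sub>R ?D z b)" by (simp add: linear_sum[OF lin] linear_scale[OF lin])
    also have "norm \<dots> \<le> (\<Sum>b\<in>Basis. \<bar>c b\<bar> * norm h)"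
    proof (rule sum_norm_le)
      fix b :: 'a assume b: "b \<in> Basis"
      have "norm ((h \<bullet> b) *\<^sub>R ?D z b) = \<bar>h \<bullet> b\<bar> * norm (?D z b)" by simp
      also have "\<dots> \<le> norm h * \<bar>c b\<bar>"
        using c[OF z, of b] Basis_le_norm[OF b, of h] by (intro mult_mono) auto
      finally show "norm ((h \<bullet> b) *\<^sub>R ?D z b) \<le> \<bar>c b\<bar> * norm h" by (simp add: mult.commute)
    qed
    finally show ?thesis by (simp add: sum_distrib_right)
  qed
  then show ?thesis by (intro exI[of _ "\<Sum>b\<in>Basis. \<bar>c b\<bar>"]) (auto intro: sum_nonneg)
qed

lemma C1_on_Lipschitz:
  fixes f :: "'a::euclidean_space \<Rightarrow> 'b::real_normed_vector"
  assumes "C1_on f W" "compact K" "K \<subseteq> W" "convex K"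
  shows "\<exists>L\<ge>0. \<forall>x\<in>K. \<forall>y\<in>K. norm (f x - f y) \<le> L * norm (x - y)"
proof -
  obtain L where L: "L \<ge> 0" "\<And>z h. z \<in> K \<Longrightarrow> norm (frechet_derivative f (at z) h) \<le> L * norm h"
    using C1_on_deriv_bound[OF assms(1-3)] by blast
  have "norm (f x - f y) \<le> L * norm (x - y)" if "x \<in> K" "y \<in> K" for x y
  proof (rule differentiable_bound[OF assms(4) _ _ that])
    show "(f has_derivative frechet_derivative f (at z)) (at z within K)" if "z \<in> K" for z
      using C1_on_has_derivative[OF assms(1)] that assms(3) by (meson has_derivative_at_withinI subsetD)
    show "onorm (frechet_derivative f (at z)) \<le> L" if "z \<in> K" for z
      using L that by (intro onorm_le) auto
  qed
  with L(1) show ?thesis by blast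
qed

lemma has_vector_derivative_iff_quotient:
  "(f has_vector_derivative D) (at t) \<longleftrightarrow> ((\<lambda>s. (f s - f t) /\<^sub>R (s - t)) \<longlongrightarrow> D) (at t)"
proof -
  have eq: "norm (f s - f t - (s - t) *\<^sub>R D) / norm (s - t) = norm ((f s - f t) /\<^sub>R (s - t) - D)"
    if "s \<noteq> t" for s
  proof -
    have "(f s - f t) /\<^sub>R (s - t) - D = (f s - f t - (s - t) *\<^sub>R D) /\<^sub>R (s - t)"
      using that by (simp add: scaleR_diff_right)
    then show ?thesis by (simp add: divide_inverse mult.commute)
  qed
  have "(f has_vector_derivative D) (at t) \<longleftrightarrow>
      ((\<lambda>s. norm (f s - f t - (s - t) *\<^sub>R D) / norm (s - t)) \<longlongrightarrow> 0) (at t)"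
    unfolding has_vector_derivative_def has_derivative_iff_norm by (simp add: bounded_linear_scaleR_left)
  also have "\<dots> \<longleftrightarrow> ((\<lambda>s. norm ((f s - f t) /\<^sub>R (s - t) - D)) \<longlongrightarrow> 0) (at t)"
    by (rule tendsto_cong) (use eq in \<open>auto simp: eventually_at_filter intro!: always_eventually\<close>)
  also have "\<dots> \<longleftrightarrow> ((\<lambda>s. (f s - f t) /\<^sub>R (s - t)) \<longlongrightarrow> D) (at t)"
    by (simp only: tendsto_norm_zero_iff LIM_zero_iff)
  finally show ?thesis .
qed

text \<open>Dominated convergence for the difference quotients based at \<open>t\<close>. The
  domination concerns these quotients and not derivatives at nearby times, so differentiability in
  \<open>s\<close> is asked only at \<open>t\<close> itself.\<close>

lemma has_vector_derivative_integral:
  fixes g :: "real \<Rightarrow> 'a \<Rightarrow> 'b::{banach, second_countable_topology}"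
  assumes "\<delta> > 0"
    and int: "\<And>s. \<bar>s - t\<bar> < \<delta> \<Longrightarrow> integrable M (g s)"
    and der: "\<And>y. y \<in> space M \<Longrightarrow> ((\<lambda>s. g s y) has_vector_derivative g' y) (at t)"
    and bound: "\<And>s y. \<bar>s - t\<bar> < \<delta> \<Longrightarrow> y \<in> space M \<Longrightarrow> norm (g s y - g t y) \<le> \<bar>s - t\<bar> * B y"
    and B: "integrable M B"
  shows "integrable M g'" "((\<lambda>s. integral\<^sup>L M (g s)) has_vector_derivative integral\<^sup>L M g') (at t)"
proof -
  let ?q = "\<lambda>s y. (g s y - g t y) /\<^sub>R (s - t)"
  have main: "integrable M g' \<and> (\<lambda>n. integral\<^sup>L M (?q (X n))) \<longlonglongrightarrow> integral\<^sup>L M g'"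
    if X: "\<And>n. X n \<noteq> t" "X \<longlonglongrightarrow> t" and near: "\<And>n. \<bar>X n - t\<bar> < \<delta>" for X
  proof -
    have lim: "(\<lambda>n. ?q (X n) y) \<longlonglongrightarrow> g' y" if "y \<in> space M" for y
    proof -
      have "((\<lambda>s. ?q s y) \<longlongrightarrow> g' y) (at t)"
        using der[OF that] by (simp add: has_vector_derivative_iff_quotient)
      then show ?thesis
        using X by (simp add: tendsto_at_iff_sequentially o_def)
    qed
    have meas: "?q (X n) \<in> borel_measurable M" for n
      using int[OF near[of n]] int[of t] \<open>\<delta> > 0\<close> by (intro borel_measurable_scaleR borel_measurable_diff) auto
    have g'm: "g' \<in> borel_measurable M"
      by (rule borel_measurable_LIMSEQ_metric[OF meas lim])
    have nb: "norm (?q (X n) y) \<le> B y" if "y \<in> space M" for n y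
      using bound[OF near that, of n] X(1)[of n] by (simp add: divide_simps mult.commute)
    have lim': "AE y in M. (\<lambda>n. ?q (X n) y) \<longlonglongrightarrow> g' y" using lim by (rule AE_I2)
    have nb': "AE y in M. norm (?q (X n) y) \<le> B y" for n using nb by (rule AE_I2)
    show ?thesis
      by (intro conjI integrable_dominated_convergence[OF g'm meas B lim' nb'] integral_dominated_convergence[OF g'm meas B lim' nb'])
  qed
  have quot: "integral\<^sup>L M (?q s) = (integral\<^sup>L M (g s) - integral\<^sup>L M (g t)) /\<^sub>R (s - t)" if "\<bar>s - t\<bar> < \<delta>" for s
  proof -
    have "integrable M (g t)" using int[of t] \<open>\<delta> > 0\<close> by simp
    then show ?thesis
      by (simp only: integral_scaleR_right Bochner_Integration.integral_diff[OF int[OF that]])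
  qed
  \<comment> \<open>Any sequence in the window that avoids \<open>t\<close> would do; its purpose is
    the integrability of \<open>g'\<close>. The factor \<open>1 / 2\<close> keeps the term with
    \<open>n = 0\<close> inside the window.\<close>
  define X where "X = (\<lambda>n. t + \<delta> / 2 * inverse (real (Suc n)))"
  have "X \<longlonglongrightarrow> t + \<delta> / 2 * 0"
    unfolding X_def by (intro tendsto_intros LIMSEQ_inverse_real_of_nat)
  then have "X \<longlonglongrightarrow> t" by simp
  moreover have "X n \<noteq> t" "\<bar>X n - t\<bar> < \<delta>" for n
  proof -
    define i where "i = inverse (real (Suc n))"
    have i: "0 < i" "i \<le> 1" by (simp_all add: i_def inverse_le_1_iff)
    have eq: "X n - t = \<delta> / 2 * i" by (simp add: X_def i_def)
    have pos: "0 < \<delta> / 2 * i" using i \<open>\<delta> > 0\<close> by simp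
    have "\<delta> / 2 * i \<le> \<delta> / 2 * 1" using i \<open>\<delta> > 0\<close> by (intro mult_left_mono) auto
    with eq pos \<open>\<delta> > 0\<close> show "X n \<noteq> t" "\<bar>X n - t\<bar> < \<delta>" by linarith+
  qed
  ultimately show "integrable M g'"
    using main[of X] by blast
  have "((\<lambda>s. (integral\<^sup>L M (g s) - integral\<^sup>L M (g t)) /\<^sub>R (s - t)) \<longlongrightarrow> integral\<^sup>L M g') (at t)"
    unfolding tendsto_at_iff_sequentially
  proof (intro allI impI)
    fix X assume X: "\<forall>i. X i \<in> UNIV - {t}" "X \<longlonglongrightarrow> t"
    \<comment> \<open>An arbitrary sequence enters the window only eventually, so the argument runs
      on the tail shifted by \<open>N\<close>.\<close>
    then obtain N where N: "\<And>n. n \<ge> N \<Longrightarrow> \<bar>X n - t\<bar> < \<delta>"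
      using \<open>\<delta> > 0\<close> unfolding LIMSEQ_iff real_norm_def by metis
    have "(\<lambda>n. integral\<^sup>L M (?q (X (n + N)))) \<longlonglongrightarrow> integral\<^sup>L M g'"
      by (rule main[of "\<lambda>n. X (n + N)", THEN conjunct2]) (use X N in \<open>auto intro: LIMSEQ_ignore_initial_segment\<close>)
    moreover have "integral\<^sup>L M (?q (X (n + N)))
        = (integral\<^sup>L M (g (X (n + N))) - integral\<^sup>L M (g t)) /\<^sub>R (X (n + N) - t)" for n
      by (rule quot[OF N]) simp
    ultimately show "((\<lambda>s. (integral\<^sup>L M (g s) - integral\<^sup>L M (g t)) /\<^sub>R (s - t)) \<circ> X) \<longlonglongrightarrow> integral\<^sup>L M g'"
      unfolding o_def by (simp only:) (rule LIMSEQ_offset)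
  qed
  then show "((\<lambda>s. integral\<^sup>L M (g s)) has_vector_derivative integral\<^sup>L M g') (at t)"
    by (simp add: has_vector_derivative_iff_quotient)
qed

lemma set_integrable_continuous_on_compact:
  fixes f :: "'a::euclidean_space \<Rightarrow> 'b::euclidean_space"
  assumes "continuous_on C f" "compact C" "K \<in> sets lebesgue" "K \<subseteq> C"
  shows "set_integrable lebesgue K f"
proof (rule set_integrable_subset[OF _ assms(3,4)])
  have "integrable lborel (\<lambda>x. indicat_real C x *\<^sub>R f x)"
    using assms by (intro borel_integrable_compact)
  then show "set_integrable lebesgue C f"
    unfolding set_integrable_def by (subst integrable_completion) auto
qed

text \<open>The volume elements of \<open>y \<mapsto> y + (s - t) w(y)\<close> are controlled through the expansion of
  \<open>det (1 + h A)\<close>, and the derivative at \<open>s = t\<close> is taken under the integral sign; this works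
  for arbitrary measurable subsets of a small ball.\<close>

lemma small_region_transport:
  fixes f :: "real \<Rightarrow> real ^ 3 \<Rightarrow> real ^ 3" and w :: "real ^ 3 \<Rightarrow> real ^ 3"
  assumes G: "open G" "(t, x0) \<in> G" and f: "C1_on (case_prod f) G" and w: "C1_on w {x. (t, x) \<in> G}"
  defines "\<phi> \<equiv> \<lambda>s y. y + (s - t) *\<^sub>R w y"
    and "T \<equiv> \<lambda>y. trace (matrix (frechet_derivative w (at y))) *\<^sub>R f t y
      + frechet_derivative (case_prod f) (at (t, y)) (1, w y)"
  shows "\<exists>r>0. cball x0 r \<subseteq> {x. (t, x) \<in> G} \<and> (\<forall>K\<in>sets lebesgue. K \<subseteq> ball x0 r \<longrightarrow>
    (\<forall>\<^sub>F s in nhds t. inj_on (\<phi> s) K \<and> \<phi> s ` K \<in> sets lebesgue \<and> set_integrable lebesgue (\<phi> s ` K) (f s)) \<and>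
    set_integrable lebesgue K T \<and>
    ((\<lambda>s. LINT x:\<phi> s ` K|lebesgue. f s x) has_vector_derivative (LINT x:K|lebesgue. T x)) (at t))"
proof -
  obtain A B where AB: "open A" "open B" "(t, x0) \<in> A \<times> B" "A \<times> B \<subseteq> G"
    using open_prod_elim[OF G] by metis
  obtain d0 where d0: "d0 > 0" "cball t d0 \<subseteq> A" using AB open_contains_cball by blast
  obtain e where e: "e > 0" "cball x0 e \<subseteq> B" using AB open_contains_cball by blast
  \<comment> \<open>The cylinder \<open>?Q\<close> is compact and convex: continuity gives uniform
    bounds on it, and the mean value inequality gives Lipschitz constants.\<close>
  let ?C = "cball x0 e" and ?Q = "cball t d0 \<times> cball x0 e"
  let ?D = "\<lambda>y. frechet_derivative w (at y)"
  have QG: "?Q \<subseteq> G" using AB(4) d0(2) e(2) by blast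
  have tQ: "t \<in> cball t d0" using d0(1) by simp
  have CW: "?C \<subseteq> {x. (t, x) \<in> G}" using QG tQ by blast
  have cQ: "compact ?Q" "convex ?Q" by (auto intro: compact_Times convex_Times)
  obtain M where M: "M \<ge> 0" "\<And>y. y \<in> ?C \<Longrightarrow> norm (w y) \<le> M"
    using continuous_on_compact_norm_bound[OF continuous_on_subset[OF C1_on_continuous[OF w] CW]] by auto
  obtain L where L: "L \<ge> 0" "\<And>x y. x \<in> ?C \<Longrightarrow> y \<in> ?C \<Longrightarrow> norm (w x - w y) \<le> L * norm (x - y)"
    using C1_on_Lipschitz[OF w _ CW] by auto
  obtain F where F: "F \<ge> 0" "\<And>z. z \<in> ?Q \<Longrightarrow> norm (case_prod f z) \<le> F"
    using continuous_on_compact_norm_bound[OF continuous_on_subset[OF C1_on_continuous[OF f] QG]] cQ by auto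
  obtain N where N: "N \<ge> 0" "\<And>x y. x \<in> ?Q \<Longrightarrow> y \<in> ?Q \<Longrightarrow> norm (case_prod f x - case_prod f y) \<le> N * norm (x - y)"
    using C1_on_Lipschitz[OF f cQ(1) QG cQ(2)] by blast
  define c1 where "c1 = (\<lambda>y. trace (matrix (?D y)))"
  define c2 where "c2 = (\<lambda>y. let A = matrix (?D y) in A$1$1 * A$2$2 + A$1$1 * A$3$3 + A$2$2 * A$3$3
    - A$1$2 * A$2$1 - A$1$3 * A$3$1 - A$2$3 * A$3$2)"
  define c3 where "c3 = (\<lambda>y. det (matrix (?D y)))"
  have cD: "continuous_on ?C (\<lambda>y. ?D y h)" for h
    using C1_on_continuous_deriv[OF w] CW continuous_on_subset by blast
  have cont: "continuous_on ?C c1" "continuous_on ?C c2" "continuous_on ?C c3"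
    unfolding c1_def c2_def c3_def trace_def det_3 Let_def matrix_def
    by (simp_all add: sum_3) (intro continuous_intros cD)+
  obtain b1 b2 b3 where b: "b1 \<ge> 0" "b2 \<ge> 0" "b3 \<ge> 0" "\<And>y. y \<in> ?C \<Longrightarrow> \<bar>c1 y\<bar> \<le> b1"
    "\<And>y. y \<in> ?C \<Longrightarrow> \<bar>c2 y\<bar> \<le> b2" "\<And>y. y \<in> ?C \<Longrightarrow> \<bar>c3 y\<bar> \<le> b3"
    using cont[THEN continuous_on_compact_norm_bound] by auto
  define J where "J = (\<lambda>h y. 1 + h * c1 y + h\<^sup>2 * c2 y + h^3 * c3 y)"
  define b where "b = b1 + b2 + b3"
  have "b \<ge> 0" using b by (simp add: b_def)
  have J1: "\<bar>J h y - 1\<bar> \<le> \<bar>h\<bar> * b" if "y \<in> ?C" "\<bar>h\<bar> \<le> 1" for h y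
  proof -
    have h: "\<bar>h\<bar>\<^sup>2 \<le> \<bar>h\<bar>" "\<bar>h\<bar>^3 \<le> \<bar>h\<bar>"
      using that(2) power_decreasing[of 1 2 "\<bar>h\<bar>"] power_decreasing[of 1 3 "\<bar>h\<bar>"] by simp_all
    have "\<bar>J h y - 1\<bar> \<le> \<bar>h * c1 y\<bar> + \<bar>h\<^sup>2 * c2 y\<bar> + \<bar>h^3 * c3 y\<bar>"
      unfolding J_def by linarith
    also have "\<dots> = \<bar>h\<bar> * \<bar>c1 y\<bar> + \<bar>h\<bar>\<^sup>2 * \<bar>c2 y\<bar> + \<bar>h\<bar>^3 * \<bar>c3 y\<bar>"
      by (simp only: abs_mult power_abs)
    also have "\<dots> \<le> \<bar>h\<bar> * b1 + \<bar>h\<bar> * b2 + \<bar>h\<bar> * b3"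
      using b(4-6)[OF that(1)] h by (intro add_mono mult_mono) auto
    finally show ?thesis by (simp add: b_def algebra_simps)
  qed
  \<comment> \<open>Points of the ball of radius \<open>r\<close> may be displaced by less than
    \<open>r\<close> and still lie in the compact ball \<open>?C\<close>, where all bounds
    hold.\<close>
  define r where "r = e / 2"
  have r: "r > 0" "ball x0 r \<subseteq> ?C" "cball x0 r \<subseteq> ?C" using e by (auto simp: r_def)
  \<comment> \<open>The five bounds serve in turn: higher powers of \<open>s - t\<close> are
    dominated by its absolute value; the time stays in \<open>cball t d0\<close>; displacements stay
    below \<open>r\<close>; the displacement map is a strict contraction, which makes
    \<open>\<phi> s\<close> injective; the volume element stays positive. Adding 1 to the
    denominators covers constants equal to 0.\<close>
  define \<delta> where "\<delta> = Min {1, d0, r / (M + 1), 1 / (L + 1), 1 / (b + 1)}"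
  have \<delta>: "\<delta> > 0" "\<delta> \<le> 1" "\<delta> \<le> d0" "\<delta> \<le> r / (M + 1)" "\<delta> \<le> 1 / (L + 1)" "\<delta> \<le> 1 / (b + 1)"
    using d0 r M(1) L(1) \<open>b \<ge> 0\<close> by (simp_all add: \<delta>_def add_nonneg_pos)
  have small: "h * c < a" if "0 \<le> h" "h < \<delta>" "\<delta> \<le> a / (c + 1)" "c \<ge> 0" for h c a
  proof -
    have "h < a / (c + 1)" using that by linarith
    then have "h * (c + 1) < a" using that(4) by (simp add: pos_less_divide_eq)
    then show ?thesis using that(1) by (simp add: algebra_simps)
  qed
  have Jpos: "J h y > 0" if "y \<in> ?C" "\<bar>h\<bar> < \<delta>" for h y
    using J1[OF that(1), of h] small[of "\<bar>h\<bar>" 1 b] that(2) \<delta> \<open>b \<ge> 0\<close> by auto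
  have \<phi>C: "\<phi> s y \<in> ?C" if "y \<in> ball x0 r" "\<bar>s - t\<bar> < \<delta>" for s y
  proof -
    have y: "y \<in> ?C" using that(1) r(2) by blast
    have "dist x0 (\<phi> s y) \<le> dist x0 y + dist y (\<phi> s y)" by (rule dist_triangle)
    also have "dist y (\<phi> s y) = \<bar>s - t\<bar> * norm (w y)" by (simp add: \<phi>_def dist_norm)
    also have "\<dots> \<le> \<bar>s - t\<bar> * M" using M(2)[OF y] by (intro mult_left_mono) auto
    also have "\<dots> < r" using small[of "\<bar>s - t\<bar>" r M] that(2) \<delta>(4) M(1) by simp
    finally show ?thesis using that(1) by (simp add: r_def)
  qed
  have inj: "inj_on (\<phi> s) (ball x0 r)" if "\<bar>s - t\<bar> < \<delta>" for s
  proof (rule inj_onI)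
    fix x y assume xy: "x \<in> ball x0 r" "y \<in> ball x0 r" "\<phi> s x = \<phi> s y"
    have "x - y = (s - t) *\<^sub>R (w y - w x)"
      using xy(3) by (simp add: \<phi>_def algebra_simps)
    then have "norm (x - y) = \<bar>s - t\<bar> * norm (w x - w y)" by (simp add: norm_minus_commute)
    also have "\<dots> \<le> \<bar>s - t\<bar> * (L * norm (x - y))"
    proof (rule mult_left_mono)
      show "norm (w x - w y) \<le> L * norm (x - y)"
        by (rule L(2)) (rule subsetD[OF r(2)], rule xy)+
    qed simp
    finally have le: "norm (x - y) \<le> \<bar>s - t\<bar> * L * norm (x - y)" by (simp add: mult.assoc)
    show "x = y"
    proof (rule ccontr)
      assume "x \<noteq> y"
      moreover have "\<bar>s - t\<bar> * L < 1"
        by (rule small[OF _ that \<delta>(5) L(1)]) simp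
      ultimately have "\<bar>s - t\<bar> * L * norm (x - y) < 1 * norm (x - y)"
        by (intro mult_strict_right_mono) auto
      then show False using le by simp
    qed
  qed
  have wder: "(w has_derivative ?D y) (at y)" if "y \<in> ?C" for y
    using C1_on_has_derivative[OF w] that CW by blast
  have \<phi>der: "(\<phi> s has_derivative (\<lambda>v. v + (s - t) *\<^sub>R ?D y v)) (at y)" if "y \<in> ?C" for s y
    unfolding \<phi>_def by (auto intro!: derivative_eq_intros wder[OF that])
  have det: "det (matrix (\<lambda>v. v + h *\<^sub>R ?D y v)) = J h y" for h y
  proof -
    have "matrix (\<lambda>v. v + h *\<^sub>R ?D y v) = mat 1 + h *\<^sub>R matrix (?D y)"
      by (simp add: matrix_def mat_def vec_eq_iff axis_def)
    then show ?thesis by (simp add: det_mat_1_plus_scaleR J_def c1_def c2_def c3_def Let_def)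
  qed
  show ?thesis
  proof (intro exI[of _ r] conjI ballI impI r(1))
    show "cball x0 r \<subseteq> {x. (t, x) \<in> G}" using r(3) CW by blast
    fix K assume K: "K \<in> sets lebesgue" "K \<subseteq> ball x0 r"
    have KC: "y \<in> ?C" if "y \<in> K" for y using K(2) r(2) that by blast
    have inQ: "(s, y) \<in> ?Q" if "\<bar>s - t\<bar> < \<delta>" "y \<in> ?C" for s y
      using that \<delta>(3) by (simp add: dist_real_def)
    have meas: "\<phi> s ` K \<in> sets lebesgue" for s
    proof (rule differentiable_image_in_sets_lebesgue[OF K(1)])
      show "\<phi> s differentiable_on K"
        using \<phi>der KC unfolding differentiable_on_def differentiable_def by (meson has_derivative_at_withinI)
    qed simp
    have fint: "set_integrable lebesgue (\<phi> s ` K) (f s)" if s: "\<bar>s - t\<bar> < \<delta>" for s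
    proof (rule set_integrable_continuous_on_compact[OF _ compact_cball meas])
      have "continuous_on ?C (\<lambda>y. case_prod f (s, y))"
        by (rule continuous_on_compose2[OF continuous_on_subset[OF C1_on_continuous[OF f] QG]])
           (use inQ[OF s] in \<open>auto intro!: continuous_intros\<close>)
      then show "continuous_on ?C (f s)" by simp
      show "\<phi> s ` K \<subseteq> ?C" using \<phi>C[OF _ s] K(2) by blast
    qed
    \<comment> \<open>Pulling the moving integral back to the fixed set \<open>K\<close> puts all
      dependence on \<open>s\<close> into the integrand. The factor \<open>J\<close> carries no
      absolute value because it is positive for these times.\<close>
    define g where "g = (\<lambda>s y. indicator K y *\<^sub>R (J (s - t) y *\<^sub>R f s (\<phi> s y)))"
    have cov: "integrable lebesgue (g s) \<and> integral\<^sup>L lebesgue (g s) = (LINT x:\<phi> s ` K|lebesgue. f s x)"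
      if s: "\<bar>s - t\<bar> < \<delta>" for s
    proof -
      let ?h = "\<lambda>y. \<bar>det (matrix (\<lambda>v. v + (s - t) *\<^sub>R ?D y v))\<bar> *\<^sub>R f s (\<phi> s y)"
      \<comment> \<open>The change of variables rule is an equivalence for a prescribed value of the
        integral. The value chosen is the integral over the image, so that the right-hand side
        reduces to integrability.\<close>
      have "(?h absolutely_integrable_on K \<and> integral K ?h = integral (\<phi> s ` K) (f s)) \<longleftrightarrow>
        (f s absolutely_integrable_on \<phi> s ` K \<and> integral (\<phi> s ` K) (f s) = integral (\<phi> s ` K) (f s))"
        by (rule has_absolute_integral_change_of_variables[OF K(1)])
           (use \<phi>der KC inj[OF s] K(2) in \<open>auto intro: has_derivative_at_withinI inj_on_subset\<close>)
      then have h: "?h absolutely_integrable_on K" "integral K ?h = integral (\<phi> s ` K) (f s)"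
        using fint[OF s] by auto
      have eq: "(\<lambda>y. indicator K y *\<^sub>R ?h y) = g s"
      proof
        show "indicator K y *\<^sub>R ?h y = g s y" for y
          using Jpos[OF KC s, of y] by (cases "y \<in> K") (simp_all add: g_def det)
      qed
      show ?thesis
        using h(1) set_lebesgue_integral_eq_integral(2)[OF h(1)] h(2) set_lebesgue_integral_eq_integral(2)[OF fint[OF s]]
        unfolding set_integrable_def set_lebesgue_integral_def eq by simp
    qed
    \<comment> \<open>\<open>b * F\<close> bounds the change caused by the volume element,
      \<open>N * (1 + M)\<close> the change of \<open>f\<close> along the trajectory, whose
      space-time velocity \<open>(1, w y)\<close> has norm at most \<open>1 + M\<close>.\<close>
    define \<Lambda> where "\<Lambda> = b * F + N * (1 + M)"
    have bound: "norm (g s y - g t y) \<le> \<bar>s - t\<bar> * (indicator K y * \<Lambda>)" if s: "\<bar>s - t\<bar> < \<delta>" for s y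
    proof (cases "y \<in> K")
      case True
      have y: "y \<in> ?C" "\<phi> s y \<in> ?C" "\<phi> t y = y" using True KC \<phi>C[OF _ s] K(2) by (auto simp: \<phi>_def)
      have Q: "(s, \<phi> s y) \<in> ?Q" "(t, y) \<in> ?Q" using inQ[OF s y(2)] inQ[of t y] y \<delta>(1) by auto
      have "norm (f s (\<phi> s y) - f t y) \<le> N * norm ((s, \<phi> s y) - (t, y))"
        using N(2)[OF Q] by simp
      also have "norm ((s, \<phi> s y) - (t, y)) \<le> \<bar>s - t\<bar> + \<bar>s - t\<bar> * norm (w y)"
        using norm_Pair_le[of "s - t" "(s - t) *\<^sub>R w y"] by (simp add: \<phi>_def)
      also have "\<dots> \<le> \<bar>s - t\<bar> * (1 + M)" using M(2)[OF y(1)] by (simp add: distrib_left mult_left_mono)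
      finally have 1: "norm (f s (\<phi> s y) - f t y) \<le> N * (\<bar>s - t\<bar> * (1 + M))" using N(1) by (simp add: mult_left_mono)
      have 2: "norm ((J (s - t) y - 1) *\<^sub>R f s (\<phi> s y)) \<le> (\<bar>s - t\<bar> * b) * F"
        using J1[OF y(1), of "s - t"] s \<delta>(2) F(2)[OF Q(1)] F(1) \<open>b \<ge> 0\<close> unfolding norm_scaleR
        by (intro mult_mono) auto
      have "g s y - g t y = (J (s - t) y - 1) *\<^sub>R f s (\<phi> s y) + (f s (\<phi> s y) - f t y)"
        using True y(3) by (simp add: g_def J_def algebra_simps)
      then have "norm (g s y - g t y) \<le> (\<bar>s - t\<bar> * b) * F + N * (\<bar>s - t\<bar> * (1 + M))"
        using norm_triangle_mono[OF 2 1] by simp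
      also have "\<dots> = \<bar>s - t\<bar> * \<Lambda>" by (simp add: \<Lambda>_def algebra_simps)
      finally show ?thesis using True by simp
    qed (simp add: g_def)
    \<comment> \<open>Product rule at \<open>s = t\<close>, where \<open>J\<close> equals 1: the
      linear coefficient \<open>c1\<close> contributes the divergence term, and \<open>f\<close>
      contributes its derivative along \<open>(1, w y)\<close>.\<close>
    have der: "((\<lambda>s. g s y) has_vector_derivative indicator K y *\<^sub>R T y) (at t)" for y
    proof (cases "y \<in> K")
      case True
      have z: "(t, y) \<in> G" using KC[OF True] CW by blast
      have "((\<lambda>s. case_prod f (s, \<phi> s y)) has_derivative (\<lambda>h. frechet_derivative (case_prod f) (at (t, y)) (h, h *\<^sub>R w y))) (at t)"
        by (rule has_derivative_compose[where f = "\<lambda>s. (s, \<phi> s y)" and g = "case_prod f"])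
           (use C1_on_has_derivative[OF f z] in \<open>auto intro!: derivative_eq_intros simp: \<phi>_def\<close>)
      moreover have "(\<lambda>h. frechet_derivative (case_prod f) (at (t, y)) (h, h *\<^sub>R w y))
          = (\<lambda>h. h *\<^sub>R frechet_derivative (case_prod f) (at (t, y)) (1, w y))"
      proof
        fix h :: real
        have "frechet_derivative (case_prod f) (at (t, y)) (h, h *\<^sub>R w y)
            = frechet_derivative (case_prod f) (at (t, y)) (h *\<^sub>R (1, w y))" by simp
        also have "\<dots> = h *\<^sub>R frechet_derivative (case_prod f) (at (t, y)) (1, w y)"
          by (rule linear_scale[OF has_derivative_linear[OF C1_on_has_derivative[OF f z]]])
        finally show "frechet_derivative (case_prod f) (at (t, y)) (h, h *\<^sub>R w y) = \<dots>" .
      qed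
      ultimately have 1: "((\<lambda>s. f s (\<phi> s y)) has_vector_derivative frechet_derivative (case_prod f) (at (t, y)) (1, w y)) (at t)"
        by (simp add: has_vector_derivative_def)
      have 2: "((\<lambda>s. J (s - t) y) has_real_derivative c1 y) (at t)"
        unfolding J_def by (auto intro!: derivative_eq_intros)
      have "((\<lambda>s. J (s - t) y *\<^sub>R f s (\<phi> s y)) has_vector_derivative
          J (t - t) y *\<^sub>R frechet_derivative (case_prod f) (at (t, y)) (1, w y) + c1 y *\<^sub>R f t (\<phi> t y)) (at t)"
        by (rule has_vector_derivative_scaleR[OF 2 1])
      then show ?thesis using True by (simp add: g_def J_def \<phi>_def T_def c1_def add.commute)
    qed (simp add: g_def)
    have "K \<in> lmeasurable"
      using K by (meson bounded_ball bounded_subset bounded_set_imp_lmeasurable)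
    then have "integrable lebesgue (\<lambda>y. indicator K y * \<Lambda>)"
      by (intro integrable_mult_left) (simp add: lmeasurable_iff_integrable)
    note DUI = has_vector_derivative_integral[OF \<delta>(1) conjunct1[OF cov] der bound this]
    show "set_integrable lebesgue K T" using DUI(1) by (simp add: set_integrable_def)
    have near: "\<forall>\<^sub>F s in nhds t. \<bar>s - t\<bar> < \<delta>"
      using eventually_nhds_metric[of "\<lambda>s. \<bar>s - t\<bar> < \<delta>" t] \<delta>(1) by (auto simp: dist_real_def)
    have ev: "\<forall>\<^sub>F s in nhds t. integral\<^sup>L lebesgue (g s) = (LINT x:\<phi> s ` K|lebesgue. f s x)"
      using near by eventually_elim (use cov in blast)
    have "((\<lambda>s. LINT x:\<phi> s ` K|lebesgue. f s x) has_vector_derivative integral\<^sup>L lebesgue (\<lambda>y. indicator K y *\<^sub>R T y)) (at t)"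
    proof (rule iffD1[OF has_vector_derivative_cong_ev DUI(2)])
      show "\<forall>\<^sub>F s in nhds t. s \<in> UNIV \<longrightarrow> integral\<^sup>L lebesgue (g s) = (LINT x:\<phi> s ` K|lebesgue. f s x)"
        using ev by eventually_elim blast
      show "integral\<^sup>L lebesgue (g t) = (LINT x:\<phi> t ` K|lebesgue. f t x)"
        using ev by (rule eventually_nhds_x_imp_x)
    qed
    then show "((\<lambda>s. LINT x:\<phi> s ` K|lebesgue. f s x) has_vector_derivative (LINT x:K|lebesgue. T x)) (at t)"
      by (simp add: set_lebesgue_integral_def)
    show "\<forall>\<^sub>F s in nhds t. inj_on (\<phi> s) K \<and> \<phi> s ` K \<in> sets lebesgue \<and> set_integrable lebesgue (\<phi> s ` K) (f s)"
      using near by eventually_elim (use meas fint inj K(2) in \<open>auto intro: inj_on_subset\<close>)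
  qed
qed

subsection \<open>Lebesgue measurability on products and localization\<close>

text \<open>Slices of a Borel function are always Borel, whereas slices of a Lebesgue measurable
  function can be arbitrary at exceptional times. A Borel version confines the difference to a null
  set; it is built coordinate by coordinate.\<close>

lemma lebesgue_measurable_ex_borel:
  fixes f :: "'a::euclidean_space \<Rightarrow> 'b::euclidean_space"
  assumes "f \<in> borel_measurable lebesgue"
  shows "\<exists>g\<in>borel_measurable lborel. AE z in lborel. f z = g z"
proof -
  have "\<exists>g\<in>borel_measurable lborel. AE z in lborel. f z \<bullet> b = g z" for b
    by (rule completion_ex_borel_measurable_real) (use assms in measurable)
  then obtain g where g: "\<And>b. g b \<in> borel_measurable lborel" "\<And>b. AE z in lborel. f z \<bullet> b = g b z"
    by metis
  have "AE z in lborel. \<forall>b\<in>Basis. f z \<bullet> b = g b z"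
    using g(2) by (simp add: AE_finite_all)
  then have "AE z in lborel. f z = (\<Sum>b\<in>Basis. g b z *\<^sub>R b)"
    by eventually_elim (metis (no_types, lifting) euclidean_representation sum.cong)
  moreover have "(\<lambda>z. \<Sum>b\<in>Basis. g b z *\<^sub>R b) \<in> borel_measurable lborel"
    using g(1) by measurable
  ultimately show ?thesis by (rule bexI[where x = "\<lambda>z. \<Sum>b\<in>Basis. g b z *\<^sub>R b"])
qed

lemma AE_lborel_slices:
  fixes P :: "'a::euclidean_space \<times> 'b::euclidean_space \<Rightarrow> bool"
  assumes "AE z in lborel. P z"
  shows "AE t in lborel. AE x in lborel. P (t, x)"
  by (rule lborel_pair.AE_pair) (use assms in \<open>unfold lborel_prod\<close>)

lemma lebesgue_measurable_slices:
  fixes f :: "'a::euclidean_space \<times> 'b::euclidean_space \<Rightarrow> 'c::euclidean_space"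
  assumes "f \<in> borel_measurable lebesgue"
  shows "AE t in lborel. (\<lambda>x. f (t, x)) \<in> borel_measurable lebesgue"
proof -
  obtain g where g: "g \<in> borel_measurable lborel" "AE z in lborel. f z = g z"
    using lebesgue_measurable_ex_borel[OF assms] by blast
  from AE_lborel_slices[OF g(2)] show ?thesis
  proof eventually_elim
    case (elim t)
    have "(\<lambda>x. g (t, x)) \<in> borel_measurable lborel" using g(1) by simp
    then have "(\<lambda>x. g (t, x)) \<in> borel_measurable lebesgue" by (rule measurable_completion)
    moreover have "AE x in lebesgue. g (t, x) = f (t, x)"
      using elim by (intro AE_completion) auto
    ultimately show ?case by (rule borel_measurable_AE)
  qed
qed

text \<open>Null slices force a null set only when the set is measurable, so Tonelli is applied to a
  Borel version of \<open>f\<close>.\<close>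

lemma AE_lborel_zero_of_slices:
  fixes f :: "'a::euclidean_space \<times> 'b::euclidean_space \<Rightarrow> 'c::euclidean_space"
  assumes "f \<in> borel_measurable lebesgue" "AE t in lborel. AE x in lborel. f (t, x) = 0"
  shows "AE z in lborel. f z = 0"
proof -
  obtain g where g: "g \<in> borel_measurable lborel" "AE z in lborel. f z = g z"
    using lebesgue_measurable_ex_borel[OF assms(1)] by blast
  have gm: "g \<in> borel_measurable (lborel \<Otimes>\<^sub>M lborel)" using g(1) by (simp add: lborel_prod)
  from AE_lborel_slices[OF g(2)] assms(2)
  have "AE t in lborel. AE x in lborel. g (t, x) = 0"
  proof eventually_elim
    case (elim t)
    then show ?case by eventually_elim simp
  qed
  then have "AE z in lborel \<Otimes>\<^sub>M lborel. g z = 0"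
    by (intro lborel_pair.AE_pair_measure) (use gm in measurable)
  then have "AE z in lborel. g z = 0" unfolding lborel_prod .
  with g(2) show ?thesis by eventually_elim simp
qed

lemma lebesgue_measurable_continuous_on_conull:
  fixes f :: "'a::euclidean_space \<Rightarrow> 'b::euclidean_space"
  assumes "open G" "AE z in lborel. z \<in> G" "continuous_on G f"
  shows "f \<in> borel_measurable lebesgue"
proof (rule borel_measurable_AE)
  have "(\<lambda>z. indicator G z *\<^sub>R f z) \<in> borel_measurable borel"
    using assms by (intro borel_measurable_continuous_on_indicator) auto
  then show "(\<lambda>z. indicator G z *\<^sub>R f z) \<in> borel_measurable lebesgue"
    by (intro measurable_completion) simp
  show "AE z in lebesgue. indicator G z *\<^sub>R f z = f z"
    using assms(2) by (intro AE_completion) auto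
qed

section \<open>Measurability of gradients\<close>

lemma lebesgue_measurable_translation:
  fixes f :: "'a::euclidean_space \<Rightarrow> 'b::topological_space"
  assumes "f \<in> borel_measurable lebesgue"
  shows "(\<lambda>z. f (z + a)) \<in> borel_measurable lebesgue"
proof -
  \<comment> \<open>The translation, written as an affine map with all coefficients equal to
    1.\<close>
  have "(\<lambda>z. a + (\<Sum>j\<in>Basis. (1 * (z \<bullet> j)) *\<^sub>R j)) \<in> lebesgue \<rightarrow>\<^sub>M lebesgue"
    by (rule lebesgue_affine_measurable) simp
  then have "(\<lambda>z. z + a) \<in> lebesgue \<rightarrow>\<^sub>M lebesgue"
    by (simp add: euclidean_representation add.commute)
  then show ?thesis using assms by (rule measurable_compose)
qed

lemma difference_quotient_LIMSEQ:
  fixes f :: "'a::real_normed_vector \<Rightarrow> real"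
  assumes "(f has_derivative d) (at x)"
  shows "(\<lambda>n. real (Suc n) * (f (x + inverse (real (Suc n)) *\<^sub>R h) - f x)) \<longlonglongrightarrow> d h"
proof -
  have "((\<lambda>s. f (x + s *\<^sub>R h)) has_derivative (\<lambda>s. d (s *\<^sub>R h))) (at 0)"
    by (rule has_derivative_compose[where f = "\<lambda>s. x + s *\<^sub>R h" and g = f])
       (use assms in \<open>auto intro!: derivative_eq_intros\<close>)
  then have "((\<lambda>s. f (x + s *\<^sub>R h)) has_vector_derivative d h) (at 0)"
    by (simp add: has_vector_derivative_def linear_scale[OF has_derivative_linear[OF assms]])
  then have lim: "((\<lambda>s. (f (x + s *\<^sub>R h) - f x) /\<^sub>R s) \<longlongrightarrow> d h) (at 0)"
    by (simp add: has_vector_derivative_iff_quotient)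
  have "(\<lambda>n. (f (x + inverse (real (Suc n)) *\<^sub>R h) - f x) /\<^sub>R inverse (real (Suc n))) \<longlonglongrightarrow> d h"
    by (rule tendsto_compose_at[OF LIMSEQ_inverse_real_of_nat lim, unfolded o_def]) simp
  then show ?thesis by (simp only: inverse_inverse_eq real_scaleR_def)
qed

text \<open>Almost everywhere the gradient is the limit of the difference quotients with steps
  \<open>1 / (n + 1)\<close>. The function given by \<open>lim\<close> is measurable without any
  convergence assumption, and its values on the exceptional null set do not matter because the
  measure is complete.\<close>

lemma lebesgue_measurable_grad:
  assumes "case_prod F \<in> borel_measurable lebesgue" "AE (t, x) in lborel. F t differentiable (at x)"
  shows "case_prod (grad F) \<in> borel_measurable lebesgue"
proof -
  define q :: "nat \<Rightarrow> 3 \<Rightarrow> real \<times> (real ^ 3) \<Rightarrow> real" where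
    "q = (\<lambda>n i z. real (Suc n) * (case_prod F (z + (0, inverse (real (Suc n)) *\<^sub>R axis i 1)) - case_prod F z))"
  have q: "q n i \<in> borel_measurable lebesgue" for n i
    unfolding q_def using assms(1) lebesgue_measurable_translation[OF assms(1)]
    by (intro borel_measurable_times borel_measurable_diff borel_measurable_const)
  have lim: "(\<lambda>z. lim (\<lambda>n. q n i z)) \<in> borel_measurable lebesgue" for i
    using q by (rule borel_measurable_lim_metric)
  have "(\<lambda>z. \<Sum>i\<in>UNIV. lim (\<lambda>n. q n i z) *\<^sub>R (axis i 1 :: real ^ 3)) \<in> borel_measurable lebesgue"
    using lim by (intro borel_measurable_sum borel_measurable_scaleR borel_measurable_const)
  moreover have "AE z in lebesgue. (\<Sum>i\<in>UNIV. lim (\<lambda>n. q n i z) *\<^sub>R axis i 1) = case_prod (grad F) z"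
  proof (rule AE_completion)
    show "AE z in lborel. (\<Sum>i\<in>UNIV. lim (\<lambda>n. q n i z) *\<^sub>R axis i 1) = case_prod (grad F) z"
      using assms(2)
    proof eventually_elim
      case (elim z)
      obtain t x where z: "z = (t, x)" by (cases z)
      have d: "(F t has_derivative frechet_derivative (F t) (at x)) (at x)"
        using elim by (simp add: z frechet_derivative_works)
      have "lim (\<lambda>n. q n i z) = frechet_derivative (F t) (at x) (axis i 1)" for i
        using difference_quotient_LIMSEQ[OF d, of "axis i 1"] unfolding q_def z by (simp add: limI)
      then show ?case unfolding z by (simp add: grad_eq[of F t, OF d] vec_eq_iff axis_def if_distrib cong: if_cong)
    qed
  qed
  ultimately show ?thesis by (rule borel_measurable_AE)
qed

section \<open>Functions whose integrals over small sets vanish\<close>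

lemma set_integrable_bounded:
  fixes f :: "'a::euclidean_space \<Rightarrow> 'b::euclidean_space"
  assumes "K \<in> lmeasurable" "f \<in> borel_measurable lebesgue" "\<And>x. x \<in> K \<Longrightarrow> norm (f x) \<le> B"
  shows "set_integrable lebesgue K f"
  unfolding set_integrable_def
proof (rule Bochner_Integration.integrable_bound)
  show "integrable lebesgue (\<lambda>x. indicator K x * B)"
    using assms(1) by (intro integrable_mult_left) (simp add: lmeasurable_iff_integrable)
  show "(\<lambda>x. indicator K x *\<^sub>R f x) \<in> borel_measurable lebesgue"
    using assms(1,2) by (intro borel_measurable_scaleR borel_measurable_indicator) (auto simp: fmeasurableD)
  show "AE x in lebesgue. norm (indicator K x *\<^sub>R f x) \<le> norm (indicator K x * B)"
  proof (rule AE_I2)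
    show "norm (indicator K x *\<^sub>R f x) \<le> norm (indicator K x * B)" for x
      using assms(3)[of x] by (cases "x \<in> K") auto
  qed
qed

text \<open>A countable cover by Borel sets of finite measure serves the completion as well, since
  both measures agree on Borel sets.\<close>

lemma sigma_finite_lebesgue: "sigma_finite_measure lebesgue"
proof
  obtain A :: "nat \<Rightarrow> 'a set" where A: "range A \<subseteq> sets lborel" "(\<Union>i. A i) = space lborel"
    "\<And>i. emeasure lborel (A i) \<noteq> \<infinity>"
    using lborel.sigma_finite by metis
  have "emeasure lebesgue (A i) \<noteq> \<infinity>" for i
    using A(3)[of i] A(1) by (simp add: range_subsetD)
  then show "\<exists>A::'a set set. countable A \<and> A \<subseteq> sets lebesgue \<and> \<Union>A = space lebesgue \<and> (\<forall>a\<in>A. emeasure lebesgue a \<noteq> \<infinity>)"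
    using A(1,2) by (intro exI[of _ "range A"]) (auto intro: sets_completionI_sets)
qed

text \<open>\<open>c\<close> need not be locally integrable, so only sets on which it is bounded are
  tested. The sets where \<open>norm (c y) \<le> n\<close> exhaust the ball, which gives a null set
  near each point of \<open>X\<close>; local negligibility implies negligibility.\<close>

lemma AE_zero_of_local_integrals:
  fixes c :: "'a::euclidean_space \<Rightarrow> 'b::euclidean_space"
  assumes c: "c \<in> borel_measurable lebesgue" and X: "open X" "AE x in lborel. x \<in> X"
    and loc: "\<And>x. x \<in> X \<Longrightarrow> \<exists>r>0. \<forall>K\<in>sets lebesgue. \<forall>n. K \<subseteq> ball x r \<longrightarrow> (\<forall>y\<in>K. norm (c y) \<le> n) \<longrightarrow>
       (LINT y:K|lebesgue. c y) = 0"
  shows "AE x in lborel. c x = 0"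
proof -
  have "negligible {x \<in> X. c x \<noteq> 0}"
  proof (rule locally_negligible_alt[THEN iffD2], rule ballI)
    fix x assume "x \<in> {x \<in> X. c x \<noteq> 0}"
    then have x: "x \<in> X" "c x \<noteq> 0" by auto
    obtain r where "r > 0" and int0: "\<forall>K\<in>sets lebesgue. \<forall>n. K \<subseteq> ball x r \<longrightarrow> (\<forall>y\<in>K. norm (c y) \<le> n) \<longrightarrow>
       (LINT y:K|lebesgue. c y) = 0" using loc[OF x(1)] by (elim exE conjE)
    define K where "K = (\<lambda>n::nat. {y \<in> ball x r. norm (c y) \<le> real n})"
    have K: "K n \<in> sets lebesgue" for n
    proof -
      have "{y \<in> space lebesgue. norm (c y) \<le> real n} \<in> sets lebesgue" using c by measurable
      then have "ball x r \<inter> {y. norm (c y) \<le> real n} \<in> sets lebesgue" by (intro sets.Int) simp_all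
      then show ?thesis by (simp add: K_def Int_def)
    qed
    have Kb: "K n \<in> lmeasurable" for n
      using K by (intro bounded_set_imp_lmeasurable) (auto intro: bounded_subset[OF bounded_ball] simp: K_def)
    have "AE y in lebesgue. indicator (K n) y *\<^sub>R c y = 0" for n
    proof (rule sigma_finite_measure.density_zero[OF sigma_finite_lebesgue])
      show "integrable lebesgue (\<lambda>y. indicator (K n) y *\<^sub>R c y)"
        using set_integrable_bounded[OF Kb c, of n "real n"] by (auto simp: K_def set_integrable_def)
      fix A :: "'a set" assume A: "A \<in> sets lebesgue"
      \<comment> \<open>Intersecting an arbitrary measurable \<open>A\<close> with
        \<open>K n\<close> gives an admissible test set, so all integrals of the truncated function
        vanish.\<close>
      have "(LINT y:A|lebesgue. indicator (K n) y *\<^sub>R c y) = (LINT y:A \<inter> K n|lebesgue. c y)"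
        unfolding set_lebesgue_integral_def by (simp add: indicator_inter_arith)
      also have "\<dots> = 0"
        by (rule int0[rule_format, of _ "real n"]) (use A K in \<open>auto simp: K_def\<close>)
      finally show "(LINT y:A|lebesgue. indicator (K n) y *\<^sub>R c y) = 0" .
    qed
    then have "AE y in lebesgue. \<forall>n. indicator (K n) y *\<^sub>R c y = 0" unfolding AE_all_countable ..
    then have "AE y in lebesgue. y \<in> ball x r \<longrightarrow> c y = 0"
    proof eventually_elim
      case (elim y)
      obtain n where "norm (c y) \<le> real n" using real_arch_simple by blast
      with elim show ?case by (auto simp: K_def indicator_def split: if_splits dest: spec[of _ n])
    qed
    then have "negligible (ball x r \<inter> {y. c y \<noteq> 0})"
      unfolding completion.AE_iff_null_sets negligible_iff_null_sets by (simp add: Int_def)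
    then have "negligible ({x \<in> X. c x \<noteq> 0} \<inter> ball x r)" by (rule negligible_subset) auto
    moreover have "openin (top_of_set {x \<in> X. c x \<noteq> 0}) ({x \<in> X. c x \<noteq> 0} \<inter> ball x r)"
      by (intro openin_open_Int) simp
    ultimately show "\<exists>U. openin (top_of_set {x \<in> X. c x \<noteq> 0}) U \<and> x \<in> U \<and> negligible U"
      using x \<open>r > 0\<close> by (intro exI[of _ "{x \<in> X. c x \<noteq> 0} \<inter> ball x r"]) auto
  qed
  then have "AE x in lebesgue. \<not> (x \<in> X \<and> c x \<noteq> 0)"
    unfolding completion.AE_iff_null_sets negligible_iff_null_sets by simp
  then have "AE x in lborel. \<not> (x \<in> X \<and> c x \<noteq> 0)" by (simp only: AE_completion_iff)
  with X(2) show ?thesis by eventually_elim simp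
qed

subsection \<open>Fluid regions\<close>

lemma C1_on_slice:
  fixes w :: "real \<Rightarrow> real ^ 3 \<Rightarrow> 'b::real_normed_vector"
  assumes "C1_on (case_prod w) G"
  shows "C1_on (w t) {x. (t, x) \<in> G}"
proof (rule C1_onI)
  show "(w t has_derivative (\<lambda>h. frechet_derivative (case_prod w) (at (t, x)) (0, h))) (at x)"
    if "x \<in> {x. (t, x) \<in> G}" for x
    using C1_field_spatial[OF assms] that by blast
  show "continuous_on {x. (t, x) \<in> G} (\<lambda>x. frechet_derivative (case_prod w) (at (t, x)) (0, h))" for h
    by (rule continuous_on_compose2[OF C1_on_continuous_deriv[OF assms], of _ "\<lambda>x. (t, x)"])
       (auto intro!: continuous_intros)
qed

text \<open>The left-hand side is what differentiating the pulled-back integral produces: the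
  divergence of the velocity times the momentum density, plus the derivative of that density along
  the motion. By the product rule, the terms with the divergence of \<open>w\<close> and the
  gradient of \<open>r\<close> combine to the divergence of the momentum density.\<close>

lemma momentum_transport_eq:
  assumes r: "C1_on (case_prod r) G" and w: "C1_on (case_prod w) G" and tx: "(t, x) \<in> G"
  defines "f \<equiv> \<lambda>s y. r s y *\<^sub>R w s y"
  shows "trace (matrix (frechet_derivative (w t) (at x))) *\<^sub>R f t x
      + frechet_derivative (case_prod f) (at (t, x)) (1, w t x) = momentum_transport r w t x"
proof -
  have f: "C1_on (case_prod f) G"
    using C1_on_scaleR[OF r w] by (simp add: f_def case_prod_unfold)
  let ?D = "frechet_derivative (case_prod f) (at (t, x))"
  have "?D (1, w t x) = ?D ((1, 0) + (0, w t x))" by simp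
  also have "\<dots> = ?D (1, 0) + ?D (0, w t x)"
    by (rule linear_add[OF has_derivative_linear[OF C1_on_has_derivative[OF f tx]]])
  finally have split: "?D (1, w t x) = time_deriv f t x + ?D (0, w t x)"
    by (simp add: C1_field_time_deriv[OF f tx])
  note dr = C1_field_spatial[OF r tx] and dw = C1_field_spatial[OF w tx] and df = C1_field_spatial[OF f tx]
  have "(f t has_derivative (\<lambda>h. r t x *\<^sub>R frechet_derivative (case_prod w) (at (t, x)) (0, h)
      + frechet_derivative (case_prod r) (at (t, x)) (0, h) *\<^sub>R w t x)) (at x)"
    unfolding f_def by (rule has_derivative_scaleR[OF dr dw])
  from has_derivative_unique[OF df this]
  have "?D (0, w t x) = r t x *\<^sub>R frechet_derivative (case_prod w) (at (t, x)) (0, w t x)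
      + frechet_derivative (case_prod r) (at (t, x)) (0, w t x) *\<^sub>R w t x"
    by (rule fun_cong)
  also have "\<dots> = r t x *\<^sub>R convect w w t x + (w t x \<bullet> grad r t x) *\<^sub>R w t x"
    using convect_eq[of w t, OF dw, of w] grad_inner[of r t, OF dr, of "w t x"] by simp
  finally have sp: "?D (0, w t x) = \<dots>" .
  have "divg f t x = r t x * divg w t x + w t x \<bullet> grad r t x"
    unfolding f_def by (rule divg_scaleR[of r t x w, OF C1_field_differentiable[OF r tx] C1_field_differentiable[OF w tx]])
  then show ?thesis
    unfolding momentum_transport_def split sp f_def[symmetric]
    by (simp add: divg_def jacobian_def) (simp add: f_def algebra_simps)
qed

lemma small_fluid_regions:
  assumes G: "open G" "(t, x0) \<in> G" and r: "C1_on (case_prod r) G" and w: "C1_on (case_prod w) G"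
  shows "\<exists>e>0. cball x0 e \<subseteq> {x. (t, x) \<in> G} \<and>
    (\<forall>K\<in>sets lebesgue. K \<subseteq> ball x0 e \<longrightarrow> (\<exists>V. V t = K \<and> fluid_region r w V t))"
proof -
  define f where "f = (\<lambda>s y. r s y *\<^sub>R w s y)"
  define \<phi> where "\<phi> = (\<lambda>s y. y + (s - t) *\<^sub>R w t y)"
  define T where "T = (\<lambda>y. trace (matrix (frechet_derivative (w t) (at y))) *\<^sub>R f t y
      + frechet_derivative (case_prod f) (at (t, y)) (1, w t y))"
  have f: "C1_on (case_prod f) G"
    using C1_on_scaleR[OF r w] by (simp add: f_def case_prod_unfold)
  obtain e where e: "e > 0" "cball x0 e \<subseteq> {x. (t, x) \<in> G}"
    and tr: "\<forall>K\<in>sets lebesgue. K \<subseteq> ball x0 e \<longrightarrow>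
      (\<forall>\<^sub>F s in nhds t. inj_on (\<phi> s) K \<and> \<phi> s ` K \<in> sets lebesgue \<and> set_integrable lebesgue (\<phi> s ` K) (f s)) \<and>
      set_integrable lebesgue K T \<and>
      ((\<lambda>s. LINT x:\<phi> s ` K|lebesgue. f s x) has_vector_derivative (LINT x:K|lebesgue. T x)) (at t)"
    using small_region_transport[OF G f C1_on_slice[OF w], folded T_def] unfolding \<phi>_def by (elim exE conjE)
  show ?thesis
  proof (intro exI[of _ e] conjI ballI impI e)
    fix K assume K: "K \<in> sets lebesgue" "K \<subseteq> ball x0 e"
    note trK = tr[rule_format, OF K]
    have Tm: "T y = momentum_transport r w t y" if "y \<in> K" for y
    proof -
      have "(t, y) \<in> G" using that K(2) e(2) ball_subset_cball by blast
      then show ?thesis unfolding T_def f_def by (rule momentum_transport_eq[OF r w])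
    qed
    \<comment> \<open>Agreement of \<open>T\<close> with the momentum transport is known on
      \<open>K\<close> only, so equality is stated for the functions cut off to
      \<open>K\<close>.\<close>
    have Tm': "(\<lambda>y. indicator K y *\<^sub>R T y) = (\<lambda>y. indicator K y *\<^sub>R momentum_transport r w t y)"
    proof
      show "indicator K y *\<^sub>R T y = indicator K y *\<^sub>R momentum_transport r w t y" for y
        using Tm[of y] by (cases "y \<in> K") simp_all
    qed
    define V where "V = (\<lambda>s. \<phi> s ` K)"
    have V: "V t = K" by (simp add: V_def \<phi>_def)
    have "moves_with w V t"
      unfolding moves_with_def
    proof (intro exI[of _ \<phi>] conjI ballI)
      show "\<phi> t x = x" for x by (simp add: \<phi>_def)
      show "((\<lambda>s. \<phi> s x) has_vector_derivative w t x) (at t)" for x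
        unfolding \<phi>_def by (auto intro!: derivative_eq_intros)
      show "\<forall>\<^sub>F s in nhds t. V s = \<phi> s ` V t \<and> inj_on (\<phi> s) (V t)"
        using trK[THEN conjunct1] unfolding V by eventually_elim (simp add: V_def)
    qed
    moreover have "\<forall>\<^sub>F s in nhds t. V s \<in> sets lebesgue \<and> set_integrable lebesgue (V s) (\<lambda>x. r s x *\<^sub>R w s x)"
      using trK[THEN conjunct1] by eventually_elim (simp add: V_def f_def)
    moreover have "set_integrable lebesgue (V t) (momentum_transport r w t)"
      using trK[THEN conjunct2, THEN conjunct1] unfolding V set_integrable_def Tm' .
    moreover have "((\<lambda>s. LINT x:V s|lebesgue. r s x *\<^sub>R w s x) has_vector_derivative
        (LINT x:V t|lebesgue. momentum_transport r w t x)) (at t)"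
      using trK[THEN conjunct2, THEN conjunct2] unfolding V set_lebesgue_integral_def Tm'
      unfolding V_def f_def .
    ultimately have "fluid_region r w V t" unfolding fluid_region_def by blast
    with V show "\<exists>V. V t = K \<and> fluid_region r w V t" by blast
  qed
qed

text \<open>The direction \<open>a\<close> varies with the point, while continuity of derivatives is
  given for fixed directions; expanding \<open>a\<close> in coordinates reconciles the two.\<close>

lemma continuous_on_convect:
  assumes "C1_on (case_prod F) G" "continuous_on G (case_prod a)"
  shows "continuous_on G (case_prod (convect a F))"
proof (rule continuous_on_cong_case_prod)
  show "continuous_on G (\<lambda>z. \<Sum>i\<in>UNIV. (case_prod a z $ i) *\<^sub>R frechet_derivative (case_prod F) (at z) (0, axis i 1))"
    by (intro continuous_intros C1_on_continuous_deriv[OF assms(1)] assms(2))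
  fix t x assume tx: "(t, x) \<in> G"
  let ?D = "\<lambda>h. frechet_derivative (case_prod F) (at (t, x)) (0, h)"
  note d = C1_field_spatial[OF assms(1) tx]
  note lin = has_derivative_linear[OF d]
  have "a t x = (\<Sum>i\<in>UNIV. a t x $ i *\<^sub>R axis i 1)"
    by (simp add: vec_eq_iff axis_def if_distrib cong: if_cong)
  then have "?D (a t x) = ?D (\<Sum>i\<in>UNIV. a t x $ i *\<^sub>R axis i 1)" by (rule arg_cong)
  also have "\<dots> = (\<Sum>i\<in>UNIV. a t x $ i *\<^sub>R ?D (axis i 1))"
    by (simp only: linear_sum[OF lin] linear_scale[OF lin])
  finally show "convect a F t x = (\<Sum>i\<in>UNIV. (case_prod a (t, x) $ i) *\<^sub>R frechet_derivative (case_prod F) (at (t, x)) (0, axis i 1))"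
    unfolding convect_eq[of F t, OF d] by simp
qed

lemma continuous_on_momentum_transport:
  assumes r: "C1_on (case_prod r) G" and w: "C1_on (case_prod w) G"
  shows "continuous_on G (case_prod (momentum_transport r w))"
proof -
  have f: "C1_on (case_prod (\<lambda>s y. r s y *\<^sub>R w s y)) G"
    using C1_on_scaleR[OF r w] by (simp add: case_prod_unfold)
  note c = continuous_on_time_deriv[OF f] continuous_on_divg[OF f] continuous_on_convect[OF w C1_on_continuous[OF w]]
    C1_on_continuous[OF w] C1_on_continuous[OF r]
  show ?thesis
    using c unfolding momentum_transport_def case_prod_unfold by (intro continuous_intros)
qed

text \<open>Localization: a region is allowed to be any measurable set on which the integrands are
  bounded, so that no local integrability of the potential gradients is needed.\<close>

lemma integral_balance_iff:
  assumes G: "open G" "AE z in lborel. z \<in> G"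
    and r: "C1_on (case_prod r) G" and w: "C1_on (case_prod w) G"
    and a: "continuous_on G (case_prod a)" and b: "continuous_on G (case_prod b)"
    and F: "case_prod F \<in> borel_measurable lebesgue"
  shows "(AE (t, x) in lborel. momentum_transport r w t x - a t x - b t x = F t x) \<longleftrightarrow>
    (AE t in lborel. \<forall>V. fluid_region r w V t \<and> set_integrable lebesgue (V t) (a t) \<and>
       set_integrable lebesgue (V t) (b t) \<and> set_integrable lebesgue (V t) (F t) \<longrightarrow>
       - (LINT x:V t|lebesgue. a t x) + total_deriv V (\<lambda>s y. r s y *\<^sub>R w s y) t - (LINT x:V t|lebesgue. b t x)
        = (LINT x:V t|lebesgue. F t x))"
  (is "?lhs \<longleftrightarrow> (AE t in lborel. ?I t)")
proof
  let ?T = "momentum_transport r w"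
  have td: "total_deriv V (\<lambda>s y. r s y *\<^sub>R w s y) t = (LINT x:V t|lebesgue. ?T t x)" if "fluid_region r w V t" for V t
    using that unfolding fluid_region_def total_deriv_def by (blast intro: vector_derivative_at)
  have sum: "set_integrable lebesgue K (\<lambda>x. ?T t x - a t x - b t x)"
      "- (LINT x:K|lebesgue. a t x) + (LINT x:K|lebesgue. ?T t x) - (LINT x:K|lebesgue. b t x)
      = (LINT x:K|lebesgue. ?T t x - a t x - b t x)"
    if "set_integrable lebesgue K (?T t)" "set_integrable lebesgue K (a t)" "set_integrable lebesgue K (b t)" for K t
    using that by simp_all
  {
    assume ?lhs
    \<comment> \<open>The exceptional set of times is fixed before any region is considered, so the
      same set serves all \<open>V\<close>.\<close>
    then have "AE t in lborel. AE x in lborel. ?T t x - a t x - b t x = F t x"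
      using AE_lborel_slices[of "\<lambda>(t, x). ?T t x - a t x - b t x = F t x"] by simp
    then show "AE t in lborel. ?I t"
    proof eventually_elim
      fix t assume "AE x in lborel. ?T t x - a t x - b t x = F t x"
      then have ae: "AE x in lebesgue. ?T t x - a t x - b t x = F t x" by (rule AE_completion)
      show "?I t"
      proof (intro allI impI, elim conjE)
        fix V assume V: "fluid_region r w V t" "set_integrable lebesgue (V t) (a t)" "set_integrable lebesgue (V t) (b t)"
          "set_integrable lebesgue (V t) (F t)"
        have T: "set_integrable lebesgue (V t) (?T t)" using V(1) by (simp add: fluid_region_def)
        have "(LINT x:V t|lebesgue. ?T t x - a t x - b t x) = (LINT x:V t|lebesgue. F t x)"
          unfolding set_lebesgue_integral_def
        proof (rule integral_cong_AE)
          show "(\<lambda>x. indicator (V t) x *\<^sub>R (?T t x - a t x - b t x)) \<in> borel_measurable lebesgue"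
            using sum(1)[OF T V(2,3)] unfolding set_integrable_def by (rule borel_measurable_integrable)
          show "(\<lambda>x. indicator (V t) x *\<^sub>R F t x) \<in> borel_measurable lebesgue"
            using V(4) unfolding set_integrable_def by (rule borel_measurable_integrable)
          show "AE x in lebesgue. indicator (V t) x *\<^sub>R (?T t x - a t x - b t x) = indicator (V t) x *\<^sub>R F t x"
            using ae by eventually_elim simp
        qed
        then show "- (LINT x:V t|lebesgue. a t x) + total_deriv V (\<lambda>s y. r s y *\<^sub>R w s y) t - (LINT x:V t|lebesgue. b t x)
          = (LINT x:V t|lebesgue. F t x)"
          using sum(2)[OF T V(2,3)] by (simp only: td[OF V(1)])
      qed
    qed
  }
  {
    assume I: "AE t in lborel. ?I t"
    define c where "c = (\<lambda>(t, x). ?T t x - a t x - b t x - F t x)"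
    have "c \<in> borel_measurable lebesgue"
      using lebesgue_measurable_continuous_on_conull[OF G continuous_on_momentum_transport[OF r w]]
        lebesgue_measurable_continuous_on_conull[OF G a] lebesgue_measurable_continuous_on_conull[OF G b] F
      unfolding c_def case_prod_unfold by (intro borel_measurable_diff)
    moreover have "AE t in lborel. AE x in lborel. c (t, x) = 0"
      using I AE_lborel_slices[OF G(2)] lebesgue_measurable_slices[OF calculation]
    proof eventually_elim
      fix t assume It: "?I t" and Gt: "AE x in lborel. (t, x) \<in> G" and cm: "(\<lambda>x. c (t, x)) \<in> borel_measurable lebesgue"
      show "AE x in lborel. c (t, x) = 0"
      proof (rule AE_zero_of_local_integrals[OF cm slice_open(1)[OF G(1)]])
        show "AE x in lborel. x \<in> {x. (t, x) \<in> G}" using Gt by simp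
        fix x assume "x \<in> {x. (t, x) \<in> G}"
        then have x: "(t, x) \<in> G" by simp
        obtain e where e: "e > 0" "cball x e \<subseteq> {x. (t, x) \<in> G}"
          and reg: "\<forall>K\<in>sets lebesgue. K \<subseteq> ball x e \<longrightarrow> (\<exists>V. V t = K \<and> fluid_region r w V t)"
          using small_fluid_regions[OF G(1) x r w] by (elim exE conjE)
        show "\<exists>e>0. \<forall>K\<in>sets lebesgue. \<forall>n. K \<subseteq> ball x e \<longrightarrow> (\<forall>y\<in>K. norm (c (t, y)) \<le> n) \<longrightarrow>
            (LINT y:K|lebesgue. c (t, y)) = 0"
        proof (intro exI[of _ e] conjI e(1) ballI allI impI)
          fix K n assume K: "K \<in> sets lebesgue" "K \<subseteq> ball x e" and n: "\<forall>y\<in>K. norm (c (t, y)) \<le> n"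
          obtain V where V: "V t = K" "fluid_region r w V t" using reg K by blast
          have slice: "continuous_on (cball x e) (g t)" if "continuous_on G (case_prod g)" for g :: vector_field
          proof -
            have "continuous_on (cball x e) (\<lambda>y. case_prod g (t, y))"
              by (rule continuous_on_compose2[OF that]) (use e(2) in \<open>auto intro!: continuous_intros\<close>)
            then show ?thesis by simp
          qed
          have K': "K \<subseteq> cball x e" using K(2) ball_subset_cball by blast
          have int: "set_integrable lebesgue K (a t)" "set_integrable lebesgue K (b t)"
            by (rule set_integrable_continuous_on_compact[OF slice _ K(1) K'], rule a b, simp)+
          have T: "set_integrable lebesgue K (?T t)" using V by (simp add: fluid_region_def)
          have "K \<in> lmeasurable"
            using K by (meson bounded_ball bounded_subset bounded_set_imp_lmeasurable)
          \<comment> \<open>Boundedness of the defect on \<open>K\<close> makes it integrable there,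
            hence also \<open>F\<close>, as a difference of integrable functions. Thus
            \<open>K\<close> is admissible in the integral equation although nothing else is known
            about the size of \<open>F\<close>.\<close>
          then have ci: "set_integrable lebesgue K (\<lambda>y. c (t, y))"
            using cm by (rule set_integrable_bounded) (use n in blast)
          have "set_integrable lebesgue K (\<lambda>y. (?T t y - a t y - b t y) - c (t, y))"
            using sum(1)[OF T int] ci by (rule set_integral_diff)
          then have Fi: "set_integrable lebesgue K (F t)" by (simp add: c_def)
          have eq: "(LINT y:K|lebesgue. ?T t y - a t y - b t y) = (LINT y:K|lebesgue. F t y)"
            using It[rule_format, of V] V int Fi sum(2)[OF T int] by (simp add: td)
          have "(LINT y:K|lebesgue. c (t, y)) = (LINT y:K|lebesgue. (?T t y - a t y - b t y) - F t y)"
            by (simp add: c_def)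
          also have "\<dots> = 0" using set_integral_diff(2)[OF sum(1)[OF T int] Fi] eq by simp
          finally show "(LINT y:K|lebesgue. c (t, y)) = 0" .
        qed
      qed
    qed
    ultimately have "AE z in lborel. c z = 0" by (rule AE_lborel_zero_of_slices)
    then show ?lhs by eventually_elim (auto simp: c_def)
  }
qed

text \<open>The part of \<open>G\<close> where \<open>f\<close> is nonzero is open and negligible,
  hence empty.\<close>

lemma continuous_on_AE_zero:
  fixes f :: "'a::euclidean_space \<Rightarrow> 'b::real_normed_vector"
  assumes "open G" "continuous_on G f" "AE z in lborel. f z = 0" "z \<in> G"
  shows "f z = 0"
proof (rule ccontr)
  assume "f z \<noteq> 0"
  have "open (G \<inter> f -` (- {0}))" using assms(1,2) by (intro continuous_open_preimage) auto
  moreover have "AE z in lebesgue. \<not> (z \<in> G \<inter> f -` (- {0}))"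
    using AE_completion[OF assms(3)] by eventually_elim simp
  then have "negligible (G \<inter> f -` (- {0}))"
    unfolding completion.AE_iff_null_sets negligible_iff_null_sets by (simp add: vimage_def Int_def)
  ultimately show False
    using open_not_negligible[of "G \<inter> f -` (- {0})"] \<open>f z \<noteq> 0\<close> assms(4) by auto
qed

subsection \<open>Flows on a regular open set\<close>

lemma time_deriv_cmult:
  assumes "C1_on (case_prod f) G" "(t, x) \<in> G"
  shows "time_deriv (\<lambda>s y. c *\<^sub>R f s y) t x = c *\<^sub>R time_deriv f t x"
  unfolding time_deriv_def[of "\<lambda>s y. c *\<^sub>R f s y"]
  by (rule vector_derivative_at[OF bounded_linear.has_vector_derivative[OF bounded_linear_scaleR_right C1_field_temporal[OF assms]]])

text \<open>The potential is absent: it enters all three equations through the same additive term,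
  and the identities below concern the other terms. \<open>G\<close> stands for an open set free of
  singularities and of zeros of \<open>\<rho>\<close>.\<close>

locale smooth_flow =
  fixes m \<zeta>\<^sub>0 \<zeta> :: real and \<rho> S \<rho>\<^sub>m \<eta> P p :: scalar_field and u v w :: vector_field
    and G :: "(real \<times> (real ^ 3)) set"
  assumes m_pos: "m > 0" and \<zeta>\<^sub>0_pos: "\<zeta>\<^sub>0 > 0"
    and \<zeta>: "\<zeta> = \<zeta>\<^sub>0 / m"
    and \<rho>\<^sub>m: "\<rho>\<^sub>m = (\<lambda>t x. m * \<rho> t x)"
    and \<eta>: "\<eta> = (\<lambda>t x. \<zeta>\<^sub>0 * \<rho> t x)"
    and v: "v = (\<lambda>t x. (1 / m) *\<^sub>R grad S t x)"
    and u: "u = (\<lambda>t x. - (\<zeta> / \<rho> t x) *\<^sub>R grad \<rho> t x)"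
    and w: "w = (\<lambda>t x. u t x + v t x)"
    and P: "P = (\<lambda>t x. \<zeta>\<^sub>0 * divg (\<lambda>s y. \<rho> s y *\<^sub>R u s y) t x)"
    and p: "p = (\<lambda>t x. - \<zeta>\<^sub>0 * divg (\<lambda>s y. \<rho> s y *\<^sub>R v s y) t x)"
    and G: "open G"
    and \<rho>_C2: "twice_C1_on (case_prod \<rho>) G"
    and S_C2: "twice_C1_on (case_prod S) G"
    and \<rho>_pos: "\<And>t x. (t, x) \<in> G \<Longrightarrow> \<rho> t x > 0"
    and continuity_ae: "AE (t, x) in lborel. time_deriv \<rho> t x + divg (\<lambda>s y. \<rho> s y *\<^sub>R v s y) t x = 0"
begin

section \<open>Velocity potentials and the regularity gained from the continuity equation\<close>

definition \<Phi> :: scalar_field where "\<Phi> = (\<lambda>t x. - \<zeta> * ln (\<rho> t x))"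

definition \<Psi> :: scalar_field where "\<Psi> = (\<lambda>t x. (1 / m) * S t x)"

lemma \<zeta>_pos: "\<zeta> > 0"
  using m_pos \<zeta>\<^sub>0_pos by (simp add: \<zeta>)

lemma C1_\<rho>: "C1_on (case_prod \<rho>) G" and C1_S: "C1_on (case_prod S) G"
  using \<rho>_C2 S_C2 by (auto simp: twice_C1_on_def)

lemma \<Phi>_C2: "twice_C1_on (case_prod \<Phi>) G"
proof -
  have "twice_C1_on (\<lambda>z. (- \<zeta>) *\<^sub>R ln (case_prod \<rho> z)) G"
    by (intro twice_C1_on_scaleR twice_C1_on_ln G \<rho>_C2) (use \<rho>_pos in auto)
  then show ?thesis by (simp add: \<Phi>_def case_prod_unfold)
qed

lemma \<Psi>_C2: "twice_C1_on (case_prod \<Psi>) G"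
proof -
  have "twice_C1_on (\<lambda>z. (1 / m) *\<^sub>R case_prod S z) G"
    by (intro twice_C1_on_scaleR G S_C2)
  then show ?thesis by (simp add: \<Psi>_def case_prod_unfold)
qed

lemma C1_\<Phi>: "C1_on (case_prod \<Phi>) G" and C1_\<Psi>: "C1_on (case_prod \<Psi>) G"
  using \<Phi>_C2 \<Psi>_C2 by (auto simp: twice_C1_on_def)

lemma u_eq: "u t x = grad \<Phi> t x" if "(t, x) \<in> G"
proof -
  note d = C1_field_spatial[OF C1_\<rho> that]
  have "((\<lambda>y. - \<zeta> * ln (\<rho> t y)) has_derivative
     (\<lambda>h. - \<zeta> * (frechet_derivative (case_prod \<rho>) (at (t, x)) (0, h) * inverse (\<rho> t x)))) (at x)"
    by (rule has_derivative_mult_right[OF has_derivative_ln[OF \<rho>_pos[OF that] d]])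
  from grad_eq[of \<Phi> t, unfolded \<Phi>_def, OF this] show ?thesis
    unfolding u grad_eq[of \<rho> t, OF d] by (simp add: \<Phi>_def vec_eq_iff divide_inverse)
qed

lemma v_eq: "v t x = grad \<Psi> t x" if "(t, x) \<in> G"
  unfolding v \<Psi>_def by (rule grad_scaleR[symmetric]) (rule C1_field_differentiable[OF C1_S that])

lemma w_eq: "w t x = grad (\<lambda>s y. \<Phi> s y + \<Psi> s y) t x" if "(t, x) \<in> G"
  unfolding w u_eq[OF that] v_eq[OF that]
  by (rule grad_add[symmetric]) (rule C1_field_differentiable[OF _ that], rule C1_\<Phi> C1_\<Psi>)+

lemma \<Phi>\<Psi>_C2: "twice_C1_on (case_prod (\<lambda>s y. \<Phi> s y + \<Psi> s y)) G"
  using twice_C1_on_scaleR_add[OF G \<Phi>_C2 \<Psi>_C2, of 1 1] by (simp add: case_prod_unfold)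

lemma C1_u: "C1_on (case_prod u) G"
  by (rule C1_on_cong[OF G _ C1_on_grad[OF G \<Phi>_C2]]) (use u_eq in auto)

lemma C1_v: "C1_on (case_prod v) G"
  by (rule C1_on_cong[OF G _ C1_on_grad[OF G \<Psi>_C2]]) (use v_eq in auto)

lemma C1_w: "C1_on (case_prod w) G"
  using C1_on_add[OF C1_u C1_v] by (simp add: w case_prod_unfold)

lemma C1_\<rho>\<^sub>m: "C1_on (case_prod \<rho>\<^sub>m) G"
  using C1_on_scaleR[OF C1_on_const C1_\<rho>, of m] by (simp add: \<rho>\<^sub>m case_prod_unfold)

lemma C1_scaleR_field:
  fixes F :: vector_field
  assumes "C1_on (case_prod r) G" "C1_on (case_prod F) G"
  shows "C1_on (case_prod (\<lambda>s y. r s y *\<^sub>R F s y)) G"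
  using C1_on_scaleR[OF assms] by (simp add: case_prod_unfold)

lemma C1_inner_uv: "C1_on (case_prod (\<lambda>s y. u s y \<bullet> v s y)) G"
  using C1_on_inner[OF C1_u C1_v] by (simp add: case_prod_unfold)

lemma continuity: "time_deriv \<rho> t x + divg (\<lambda>s y. \<rho> s y *\<^sub>R v s y) t x = 0" if "(t, x) \<in> G"
proof -
  have "(\<lambda>(t, x). time_deriv \<rho> t x + divg (\<lambda>s y. \<rho> s y *\<^sub>R v s y) t x) (t, x) = 0"
  proof (rule continuous_on_AE_zero[OF G _ _ that])
    show "continuous_on G (\<lambda>(t, x). time_deriv \<rho> t x + divg (\<lambda>s y. \<rho> s y *\<^sub>R v s y) t x)"
      using continuous_on_time_deriv[OF C1_\<rho>] continuous_on_divg[OF C1_scaleR_field[OF C1_\<rho> C1_v]]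
      unfolding case_prod_unfold by (rule continuous_on_add)
    show "AE z in lborel. (case z of (t, x) \<Rightarrow> time_deriv \<rho> t x + divg (\<lambda>s y. \<rho> s y *\<^sub>R v s y) t x) = 0"
      using continuity_ae by eventually_elim auto
  qed
  then show ?thesis by simp
qed

lemma p_eq: "p t x = \<zeta>\<^sub>0 *\<^sub>R time_deriv \<rho> t x" if "(t, x) \<in> G"
proof -
  have "divg (\<lambda>s y. \<rho> s y *\<^sub>R v s y) t x = - time_deriv \<rho> t x"
    using continuity[OF that] by linarith
  then show ?thesis by (simp add: p)
qed

text \<open>By definition \<open>p\<close> contains second derivatives of \<open>S\<close> and would
  be merely continuous. As a multiple of the time derivative of \<open>\<rho>\<close> it is C1, so
  \<open>grad p\<close> is meaningful on \<open>G\<close>.\<close>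

lemma C1_p: "C1_on (case_prod p) G"
proof (rule C1_on_cong[OF G])
  show "C1_on (\<lambda>z. \<zeta>\<^sub>0 *\<^sub>R case_prod (time_deriv \<rho>) z) G"
    by (intro C1_on_scaleR C1_on_const C1_on_time_deriv G \<rho>_C2)
qed (use p_eq in auto)

text \<open>Multiplication by the mass density cancels the quotient in \<open>u\<close> and leaves
  \<open>- \<zeta>\<^sub>0\<close> times the gradient of \<open>\<rho>\<close>, whose time
  derivative is found by commuting derivatives.\<close>

lemma time_deriv_\<rho>\<^sub>m_u: "time_deriv (\<lambda>s y. \<rho>\<^sub>m s y *\<^sub>R u s y) t x = - grad p t x" if "(t, x) \<in> G"
proof -
  have "\<rho>\<^sub>m s y *\<^sub>R u s y = (- \<zeta>\<^sub>0) *\<^sub>R grad \<rho> s y" if "(s, y) \<in> G" for s y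
    using \<rho>_pos[OF that] m_pos by (simp add: \<rho>\<^sub>m u \<zeta>)
  then have "time_deriv (\<lambda>s y. \<rho>\<^sub>m s y *\<^sub>R u s y) t x = time_deriv (\<lambda>s y. (- \<zeta>\<^sub>0) *\<^sub>R grad \<rho> s y) t x"
    by (rule time_deriv_cong[OF G that])
  also have "\<dots> = (- \<zeta>\<^sub>0) *\<^sub>R time_deriv (grad \<rho>) t x"
    by (rule time_deriv_cmult[OF C1_on_grad[OF G \<rho>_C2] that])
  also have "time_deriv (grad \<rho>) t x = grad (time_deriv \<rho>) t x"
    by (rule time_deriv_grad[OF G \<rho>_C2 that])
  also have "(- \<zeta>\<^sub>0) *\<^sub>R grad (time_deriv \<rho>) t x = - grad (\<lambda>s y. \<zeta>\<^sub>0 * time_deriv \<rho> s y) t x"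
    using grad_scaleR[of "time_deriv \<rho>" t, OF C1_field_differentiable[OF C1_on_time_deriv[OF G \<rho>_C2] that], of \<zeta>\<^sub>0] by simp
  also have "grad (\<lambda>s y. \<zeta>\<^sub>0 * time_deriv \<rho> s y) t x = grad p t x"
    by (rule grad_cong[OF G that]) (simp add: p_eq)
  finally show ?thesis .
qed

text \<open>The continuity equation divided by \<open>\<rho>\<close> and multiplied by
  \<open>\<zeta>\<close>: the logarithmic gradient of \<open>\<rho>\<close> times
  \<open>- \<zeta>\<close> is again \<open>u\<close>. The factor \<open>(- 1)\<close> is kept
  explicit to match \<open>grad_scaleR\<close>.\<close>

lemma time_deriv_\<Phi>: "time_deriv \<Phi> t x = \<zeta> * divg v t x + (- 1) * (u t x \<bullet> v t x)" if tx: "(t, x) \<in> G"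
proof -
  have "((\<lambda>s. \<rho> s x) has_real_derivative time_deriv \<rho> t x) (at t)"
    using C1_field_temporal[OF C1_\<rho> tx] by (simp add: has_real_derivative_iff_has_vector_derivative)
  then have "((\<lambda>s. \<Phi> s x) has_real_derivative - \<zeta> * (time_deriv \<rho> t x / \<rho> t x)) (at t)"
    unfolding \<Phi>_def using \<rho>_pos[OF tx] by (auto intro!: derivative_eq_intros)
  then have "time_deriv \<Phi> t x = - \<zeta> * (time_deriv \<rho> t x / \<rho> t x)"
    unfolding time_deriv_def by (intro vector_derivative_at) (simp add: has_real_derivative_iff_has_vector_derivative)
  moreover have "time_deriv \<rho> t x = - (\<rho> t x * divg v t x + v t x \<bullet> grad \<rho> t x)"
    using continuity[OF tx] divg_scaleR[of \<rho> t x v, OF C1_field_differentiable[OF C1_\<rho> tx] C1_field_differentiable[OF C1_v tx]]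
    by linarith
  moreover have "u t x \<bullet> v t x = - (\<zeta> / \<rho> t x) * (v t x \<bullet> grad \<rho> t x)"
    by (simp add: u inner_commute)
  ultimately show ?thesis using \<rho>_pos[OF tx] by (simp only:) (simp add: add_divide_distrib algebra_simps)
qed

text \<open>C2 regularity of \<open>S\<close> alone makes the divergence only continuous. Solving
  the formula for \<open>time_deriv \<Phi>\<close> for \<open>divg v\<close> expresses it through C1
  functions, so \<open>grad (divg v)\<close> exists without third derivatives of
  \<open>S\<close>.\<close>

lemma C1_divg_v: "C1_on (case_prod (divg v)) G"
proof (rule C1_on_cong[OF G])
  show "C1_on (\<lambda>z. inverse \<zeta> *\<^sub>R (case_prod (time_deriv \<Phi>) z + case_prod (\<lambda>s y. u s y \<bullet> v s y) z)) G"
    by (intro C1_on_scaleR C1_on_const C1_on_add C1_on_time_deriv C1_inner_uv G \<Phi>_C2)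
  show "case_prod (divg v) z = inverse \<zeta> *\<^sub>R (case_prod (time_deriv \<Phi>) z + case_prod (\<lambda>s y. u s y \<bullet> v s y) z)"
    if "z \<in> G" for z
    using that \<zeta>_pos by (cases z) (simp add: time_deriv_\<Phi>)
qed

lemma time_deriv_u:
  assumes tx: "(t, x) \<in> G"
  shows "time_deriv u t x = \<zeta> *\<^sub>R grad (divg v) t x - grad (\<lambda>s y. u s y \<bullet> v s y) t x"
proof -
  have "time_deriv u t x = time_deriv (grad \<Phi>) t x" by (rule time_deriv_cong[OF G tx]) (rule u_eq)
  also have "\<dots> = grad (time_deriv \<Phi>) t x" by (rule time_deriv_grad[OF G \<Phi>_C2 tx])
  also have "\<dots> = grad (\<lambda>s y. \<zeta> * divg v s y + (- 1) * (u s y \<bullet> v s y)) t x"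
    by (rule grad_cong[OF G tx]) (rule time_deriv_\<Phi>)
  also have "\<dots> = grad (\<lambda>s y. \<zeta> * divg v s y) t x + grad (\<lambda>s y. (- 1) * (u s y \<bullet> v s y)) t x"
    by (rule grad_add; rule differentiable_mult[OF differentiable_const])
       (rule C1_field_differentiable[OF C1_divg_v tx] C1_field_differentiable[OF C1_inner_uv tx])+
  also have "grad (\<lambda>s y. \<zeta> * divg v s y) t x = \<zeta> *\<^sub>R grad (divg v) t x"
    by (rule grad_scaleR[of "divg v" t, OF C1_field_differentiable[OF C1_divg_v tx]])
  also have "grad (\<lambda>s y. (- 1) * (u s y \<bullet> v s y)) t x = (- 1) *\<^sub>R grad (\<lambda>s y. u s y \<bullet> v s y) t x"
    by (rule grad_scaleR[of "\<lambda>s y. u s y \<bullet> v s y" t, OF C1_field_differentiable[OF C1_inner_uv tx]])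
  finally show ?thesis by simp
qed

lemma grad_norm_w:
  assumes tx: "(t, x) \<in> G"
  shows "grad (\<lambda>s y. (norm (w s y))\<^sup>2) t x
    = grad (\<lambda>s y. (norm (u s y))\<^sup>2 + (norm (v s y))\<^sup>2) t x + 2 *\<^sub>R grad (\<lambda>s y. u s y \<bullet> v s y) t x"
proof -
  have eq: "(\<lambda>s y. (norm (w s y))\<^sup>2) = (\<lambda>s y. ((norm (u s y))\<^sup>2 + (norm (v s y))\<^sup>2) + 2 * (u s y \<bullet> v s y))"
    by (intro ext) (simp add: w power2_norm_eq_inner algebra_simps inner_commute)
  have "C1_on (case_prod (\<lambda>s y. (norm (u s y))\<^sup>2 + (norm (v s y))\<^sup>2)) G"
    using C1_on_add[OF C1_on_inner[OF C1_u C1_u] C1_on_inner[OF C1_v C1_v]]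
    by (simp add: power2_norm_eq_inner case_prod_unfold)
  note d = C1_field_differentiable[OF this tx] and duv = C1_field_differentiable[OF C1_inner_uv tx]
  have "grad (\<lambda>s y. (norm (w s y))\<^sup>2) t x = grad (\<lambda>s y. (norm (u s y))\<^sup>2 + (norm (v s y))\<^sup>2) t x + grad (\<lambda>s y. 2 * (u s y \<bullet> v s y)) t x"
    unfolding eq
    by (rule grad_add[of "\<lambda>s y. (norm (u s y))\<^sup>2 + (norm (v s y))\<^sup>2" t x "\<lambda>s y. 2 * (u s y \<bullet> v s y)",
          OF d differentiable_mult[OF differentiable_const duv]])
  then show ?thesis using grad_scaleR[of "\<lambda>s y. u s y \<bullet> v s y" t, OF duv, of 2] by simp
qed

lemma time_deriv_w: "time_deriv w t x = time_deriv u t x + time_deriv v t x" if "(t, x) \<in> G"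
  unfolding w by (rule time_deriv_add[OF C1_u C1_v that])

text \<open>The gradient of \<open>u \<bullet> v\<close> in the time derivative of \<open>u\<close>
  cancels the cross term of the squared norm of \<open>u + v\<close>. What survives is the gradient
  of the divergence, with coefficient \<open>\<rho>\<^sub>m \<zeta> = \<eta>\<close>.\<close>

lemma acceleration_w:
  assumes tx: "(t, x) \<in> G"
  shows "\<rho>\<^sub>m t x *\<^sub>R time_deriv w t x + (1 / 2 * \<rho>\<^sub>m t x) *\<^sub>R grad (\<lambda>s y. (norm (w s y))\<^sup>2) t x
    = \<rho>\<^sub>m t x *\<^sub>R time_deriv v t x
      + (1 / 2 * \<rho>\<^sub>m t x) *\<^sub>R grad (\<lambda>s y. (norm (u s y))\<^sup>2 + (norm (v s y))\<^sup>2) t x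
      + \<eta> t x *\<^sub>R grad (divg v) t x"
proof -
  have "\<rho>\<^sub>m t x * \<zeta> = \<eta> t x" using m_pos by (simp add: \<rho>\<^sub>m \<eta> \<zeta>)
  then have "\<rho>\<^sub>m t x *\<^sub>R time_deriv u t x = \<eta> t x *\<^sub>R grad (divg v) t x - \<rho>\<^sub>m t x *\<^sub>R grad (\<lambda>s y. u s y \<bullet> v s y) t x"
    unfolding time_deriv_u[OF tx] by (simp add: scaleR_diff_right)
  then show ?thesis
    unfolding time_deriv_w[OF tx] grad_norm_w[OF tx] by (simp add: scaleR_add_right)
qed

lemma time_deriv_\<rho>\<^sub>m: "time_deriv \<rho>\<^sub>m t x = - divg (\<lambda>s y. \<rho>\<^sub>m s y *\<^sub>R v s y) t x" if tx: "(t, x) \<in> G"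
proof -
  have "time_deriv \<rho>\<^sub>m t x = m * time_deriv \<rho> t x"
    using time_deriv_cmult[OF C1_\<rho> tx, of m] by (simp add: \<rho>\<^sub>m)
  also have "\<dots> = - (m * divg (\<lambda>s y. \<rho> s y *\<^sub>R v s y) t x)"
    using continuity[OF tx] by (simp add: eq_neg_iff_add_eq_0 distrib_left[symmetric])
  also have "m * divg (\<lambda>s y. \<rho> s y *\<^sub>R v s y) t x = divg (\<lambda>s y. \<rho>\<^sub>m s y *\<^sub>R v s y) t x"
  proof -
    note dv = C1_field_differentiable[OF C1_v tx]
    have "grad \<rho>\<^sub>m t x = m *\<^sub>R grad \<rho> t x"
      unfolding \<rho>\<^sub>m by (rule grad_scaleR[of \<rho> t, OF C1_field_differentiable[OF C1_\<rho> tx]])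
    then show ?thesis
      using divg_scaleR[of \<rho> t x v, OF C1_field_differentiable[OF C1_\<rho> tx] dv]
        divg_scaleR[of \<rho>\<^sub>m t x v, OF C1_field_differentiable[OF C1_\<rho>\<^sub>m tx] dv]
      by (simp add: \<rho>\<^sub>m distrib_left)
  qed
  finally show ?thesis .
qed

text \<open>\<open>w\<close> is itself a gradient, so the convective term is half the gradient of
  its squared norm. In the divergence of the momentum density the part with \<open>v\<close> cancels
  against the time derivative of \<open>\<rho>\<^sub>m\<close>; the part with \<open>u\<close>
  remains as the source of mass.\<close>

lemma momentum_transport_w:
  assumes tx: "(t, x) \<in> G"
  shows "momentum_transport \<rho>\<^sub>m w t x
    = \<rho>\<^sub>m t x *\<^sub>R time_deriv w t x + (1 / 2 * \<rho>\<^sub>m t x) *\<^sub>R grad (\<lambda>s y. (norm (w s y))\<^sup>2) t x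
      + divg (\<lambda>s y. \<rho>\<^sub>m s y *\<^sub>R u s y) t x *\<^sub>R w t x"
proof -
  let ?h = "\<lambda>s y. \<Phi> s y + \<Psi> s y"
  have "convect w w t x = convect (grad ?h) (grad ?h) t x"
    by (rule convect_cong[OF G tx]) (rule w_eq)
  also have "\<dots> = (1 / 2) *\<^sub>R grad (\<lambda>s y. (norm (grad ?h s y))\<^sup>2) t x"
    by (rule convect_grad[OF G \<Phi>\<Psi>_C2 tx])
  also have "grad (\<lambda>s y. (norm (grad ?h s y))\<^sup>2) t x = grad (\<lambda>s y. (norm (w s y))\<^sup>2) t x"
    by (rule grad_cong[OF G tx]) (simp add: w_eq)
  finally have cw: "convect w w t x = (1 / 2) *\<^sub>R grad (\<lambda>s y. (norm (w s y))\<^sup>2) t x" .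
  have "divg (\<lambda>s y. \<rho>\<^sub>m s y *\<^sub>R w s y) t x = divg (\<lambda>s y. \<rho>\<^sub>m s y *\<^sub>R u s y + \<rho>\<^sub>m s y *\<^sub>R v s y) t x"
    by (simp add: w scaleR_add_right)
  also have "\<dots> = divg (\<lambda>s y. \<rho>\<^sub>m s y *\<^sub>R u s y) t x + divg (\<lambda>s y. \<rho>\<^sub>m s y *\<^sub>R v s y) t x"
    by (rule divg_add; rule C1_field_differentiable[OF C1_scaleR_field[OF C1_\<rho>\<^sub>m] tx]; rule C1_u C1_v)
  finally have dw: "divg (\<lambda>s y. \<rho>\<^sub>m s y *\<^sub>R w s y) t x = divg (\<lambda>s y. \<rho>\<^sub>m s y *\<^sub>R u s y) t x - time_deriv \<rho>\<^sub>m t x"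
    by (simp add: time_deriv_\<rho>\<^sub>m[OF tx])
  show ?thesis
    unfolding momentum_transport_def time_deriv_scaleR[OF C1_\<rho>\<^sub>m C1_w tx] cw dw
    by (simp add: algebra_simps)
qed

lemma momentum_balance_w:
  assumes tx: "(t, x) \<in> G"
  shows "momentum_transport \<rho>\<^sub>m w t x - divg (\<lambda>s y. \<rho>\<^sub>m s y *\<^sub>R u s y) t x *\<^sub>R v t x
    = \<rho>\<^sub>m t x *\<^sub>R time_deriv w t x + (1 / 2 * \<rho>\<^sub>m t x) *\<^sub>R grad (\<lambda>s y. (norm (w s y))\<^sup>2) t x
      + divg (\<lambda>s y. \<rho>\<^sub>m s y *\<^sub>R u s y) t x *\<^sub>R u t x"
  unfolding momentum_transport_w[OF tx] by (simp add: w scaleR_add_right)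

text \<open>The divergence of \<open>\<rho>\<^sub>m v\<close> is minus the time derivative of
  \<open>\<rho>\<^sub>m\<close>, so subtracting its product with \<open>u\<close> completes
  \<open>\<rho>\<^sub>m\<close> times the derivative of \<open>u\<close> to the derivative of the
  product. Subtracting \<open>\<rho>\<^sub>m grad (u \<bullet> v)\<close> removes the cross term of
  the squared norm of \<open>w\<close>.\<close>

lemma momentum_balance_uv:
  assumes tx: "(t, x) \<in> G"
  shows "momentum_transport \<rho>\<^sub>m w t x - divg (\<lambda>s y. \<rho>\<^sub>m s y *\<^sub>R v s y) t x *\<^sub>R u t x
      - (divg (\<lambda>s y. \<rho>\<^sub>m s y *\<^sub>R u s y) t x *\<^sub>R v t x + \<rho>\<^sub>m t x *\<^sub>R grad (\<lambda>s y. u s y \<bullet> v s y) t x)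
    = time_deriv (\<lambda>s y. \<rho>\<^sub>m s y *\<^sub>R u s y) t x + \<rho>\<^sub>m t x *\<^sub>R time_deriv v t x
      + (1 / 2 * \<rho>\<^sub>m t x) *\<^sub>R grad (\<lambda>s y. (norm (u s y))\<^sup>2 + (norm (v s y))\<^sup>2) t x
      + divg (\<lambda>s y. \<rho>\<^sub>m s y *\<^sub>R u s y) t x *\<^sub>R u t x"
proof -
  have dv: "divg (\<lambda>s y. \<rho>\<^sub>m s y *\<^sub>R v s y) t x = - time_deriv \<rho>\<^sub>m t x"
    by (simp add: time_deriv_\<rho>\<^sub>m[OF tx])
  show ?thesis
    unfolding momentum_transport_w[OF tx] time_deriv_scaleR[OF C1_\<rho>\<^sub>m C1_u tx] dv time_deriv_w[OF tx] grad_norm_w[OF tx]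
    by (simp add: w scaleR_add_right)
qed

text \<open>\<open>P\<close> contains second derivatives of \<open>\<rho>\<close>, so continuity is
  what C2 regularity gives. It yields the measurability of \<open>P\<close> from which that of
  \<open>grad P\<close> is derived.\<close>

lemma continuous_on_P: "continuous_on G (case_prod P)"
  using continuous_on_mult_left[OF continuous_on_divg[OF C1_scaleR_field[OF C1_\<rho> C1_u]], of \<zeta>\<^sub>0]
  by (simp add: P case_prod_unfold)

end

subsection \<open>The regular set\<close>

lemma twice_C1_on_subset:
  assumes "open W" "twice_C1_on f W" "G \<subseteq> W"
  shows "twice_C1_on f G"
  by (rule twice_C1_on_local) (use assms in blast)

text \<open>The union of all open sets on which the function is C2 is open, and its complement lies
  in the exceptional null set.\<close>

lemma C2_ae_open_conull:
  assumes "C2_ae f"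
  shows "\<exists>G. open G \<and> (AE z in lborel. z \<in> G) \<and> twice_C1_on f G"
proof (intro exI conjI)
  let ?G = "\<Union>{W. open W \<and> C2_on f W}"
  show "open ?G" by blast
  show "AE z in lborel. z \<in> ?G" using assms unfolding C2_ae_def by eventually_elim blast
  show "twice_C1_on f ?G"
    by (rule twice_C1_on_local) (use C2_on_imp_twice_C1_on in blast)
qed

text \<open>The zeros are null at each fixed time. Inside \<open>G\<close> they form a Borel set of
  space-time, a difference of open sets, so Tonelli makes them null there too.\<close>

lemma nonzero_open_conull:
  fixes f :: "real \<Rightarrow> real ^ 3 \<Rightarrow> real"
  assumes G: "open G" "AE z in lborel. z \<in> G" and f: "continuous_on G (case_prod f)"
    and zeros: "\<And>t. negligible {x. f t x = 0}"
  shows "open {z \<in> G. case_prod f z \<noteq> 0}" "AE z in lborel. z \<in> {z \<in> G. case_prod f z \<noteq> 0}"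
proof -
  let ?N = "{z \<in> G. case_prod f z \<noteq> 0}"
  have "open (G \<inter> case_prod f -` (- {0}))"
    using f G(1) by (intro continuous_open_preimage) auto
  then show N: "open ?N" by (simp add: vimage_def Int_def)
  let ?i = "\<lambda>z. indicator (G - ?N) z :: real"
  have "?i \<in> borel_measurable lborel" using G(1) N by (intro borel_measurable_indicator) auto
  then have m: "?i \<in> borel_measurable lebesgue" by (rule measurable_completion)
  have "AE x in lborel. ?i (t, x) = 0" for t
  proof -
    have "AE x in lebesgue. f t x \<noteq> 0"
      using zeros[of t] unfolding completion.AE_iff_null_sets negligible_iff_null_sets by simp
    then have "AE x in lborel. f t x \<noteq> 0" by (simp only: AE_completion_iff)
    then show ?thesis by eventually_elim (simp add: indicator_def)
  qed
  then have "AE z in lborel. ?i z = 0" by (intro AE_lborel_zero_of_slices[OF m]) simp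
  with G(2) show "AE z in lborel. z \<in> ?N" by eventually_elim (auto simp: indicator_def split: if_splits)
qed

text \<open>The integrability conditions in the two integral forms secure their meaning: the
  integral of a non-integrable function is 0 by convention, which would turn the balance into an
  unrelated equation.\<close>

theorem theorem6:
  fixes hbar m \<zeta>\<^sub>0 \<zeta> :: real
    and \<rho> S U \<rho>\<^sub>m \<eta> P p :: "real \<Rightarrow> real ^ 3 \<Rightarrow> real"
    and u v w :: "real \<Rightarrow> real ^ 3 \<Rightarrow> real ^ 3"
  assumes "hbar > 0" and "m > 0"
    and \<rho>_nonneg: "\<And>t x. \<rho> t x \<ge> 0"
    and \<rho>_C2: "C2_ae (\<lambda>(t, x). \<rho> t x)"
    and S_C2: "C2_ae (\<lambda>(t, x). S t x)"
    and \<rho>_prob: "\<And>t. has_bochner_integral lebesgue (\<rho> t) 1"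
    and \<rho>_zeros: "\<And>t. negligible {x. \<rho> t x = 0}"
    and \<zeta>\<^sub>0: "\<zeta>\<^sub>0 = hbar / 2"
    and \<zeta>: "\<zeta> = \<zeta>\<^sub>0 / m"
    and \<rho>\<^sub>m: "\<rho>\<^sub>m = (\<lambda>t x. m * \<rho> t x)"
    and \<eta>: "\<eta> = (\<lambda>t x. \<zeta>\<^sub>0 * \<rho> t x)"
    and v: "v = (\<lambda>t x. (1 / m) *\<^sub>R grad S t x)"
    and u: "u = (\<lambda>t x. - (\<zeta> / \<rho> t x) *\<^sub>R grad \<rho> t x)"
    and w: "w = (\<lambda>t x. u t x + v t x)"
    and P: "P = (\<lambda>t x. \<zeta>\<^sub>0 * divg (\<lambda>s y. \<rho> s y *\<^sub>R u s y) t x)"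
    and p: "p = (\<lambda>t x. - \<zeta>\<^sub>0 * divg (\<lambda>s y. \<rho> s y *\<^sub>R v s y) t x)"
    and U_measurable: "(\<lambda>(t, x). U t x) \<in> borel_measurable lebesgue"
    and U_gradient: "AE (t, x) in lborel. U t differentiable (at x)"
    and P_gradient: "AE (t, x) in lborel. P t differentiable (at x)"
    and continuity:
      "AE (t, x) in lborel. time_deriv \<rho> t x + divg (\<lambda>s y. \<rho> s y *\<^sub>R v s y) t x = 0"
  defines "eq1 \<equiv> AE (t, x) in lborel.
        \<rho>\<^sub>m t x *\<^sub>R time_deriv v t x
        + (1 / 2 * \<rho>\<^sub>m t x) *\<^sub>R grad (\<lambda>s y. (norm (u s y))\<^sup>2 + (norm (v s y))\<^sup>2) t x
        + grad P t x
        + divg (\<lambda>s y. \<rho>\<^sub>m s y *\<^sub>R u s y) t x *\<^sub>R u t x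
        + \<rho> t x *\<^sub>R grad U t x = 0"
    and "eq2 \<equiv> AE (t, x) in lborel.
        \<rho>\<^sub>m t x *\<^sub>R time_deriv w t x
        + (1 / 2 * \<rho>\<^sub>m t x) *\<^sub>R grad (\<lambda>s y. (norm (w s y))\<^sup>2) t x
        + grad P t x
        + \<rho> t x *\<^sub>R grad U t x
        + divg (\<lambda>s y. \<rho>\<^sub>m s y *\<^sub>R u s y) t x *\<^sub>R u t x
        = \<eta> t x *\<^sub>R grad (divg v) t x"
    and "eq3 \<equiv> AE (t, x) in lborel.
        time_deriv (\<lambda>s y. \<rho>\<^sub>m s y *\<^sub>R u s y) t x
        + \<rho>\<^sub>m t x *\<^sub>R time_deriv v t x
        + (1 / 2 * \<rho>\<^sub>m t x) *\<^sub>R grad (\<lambda>s y. (norm (u s y))\<^sup>2 + (norm (v s y))\<^sup>2) t x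
        + grad (\<lambda>s y. P s y + p s y) t x
        + divg (\<lambda>s y. \<rho>\<^sub>m s y *\<^sub>R u s y) t x *\<^sub>R u t x
        + \<rho> t x *\<^sub>R grad U t x = 0"
  shows "(eq1 \<longleftrightarrow> eq2) \<and> (eq2 \<longleftrightarrow> eq3) \<and>
    (eq2 \<longleftrightarrow>
      (AE t in lborel. \<forall>V.
        fluid_region \<rho>\<^sub>m w V t \<and>
        set_integrable lebesgue (V t) (\<lambda>x. divg (\<lambda>s y. \<rho>\<^sub>m s y *\<^sub>R u s y) t x *\<^sub>R v t x) \<and>
        set_integrable lebesgue (V t)
          (\<lambda>x. - grad P t x - \<rho> t x *\<^sub>R grad U t x + \<eta> t x *\<^sub>R grad (divg v) t x)
        \<longrightarrow>
        total_deriv V (\<lambda>s y. \<rho>\<^sub>m s y *\<^sub>R w s y) t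
        - (LINT x:V t|lebesgue. divg (\<lambda>s y. \<rho>\<^sub>m s y *\<^sub>R u s y) t x *\<^sub>R v t x)
        = (LINT x:V t|lebesgue.
             - grad P t x - \<rho> t x *\<^sub>R grad U t x + \<eta> t x *\<^sub>R grad (divg v) t x))) \<and>
    (eq3 \<longleftrightarrow>
      (AE t in lborel. \<forall>V.
        fluid_region \<rho>\<^sub>m w V t \<and>
        set_integrable lebesgue (V t) (\<lambda>x. divg (\<lambda>s y. \<rho>\<^sub>m s y *\<^sub>R v s y) t x *\<^sub>R u t x) \<and>
        set_integrable lebesgue (V t)
          (\<lambda>x. divg (\<lambda>s y. \<rho>\<^sub>m s y *\<^sub>R u s y) t x *\<^sub>R v t x
               + \<rho>\<^sub>m t x *\<^sub>R grad (\<lambda>s y. u s y \<bullet> v s y) t x) \<and>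
        set_integrable lebesgue (V t)
          (\<lambda>x. - grad P t x - grad p t x - \<rho> t x *\<^sub>R grad U t x)
        \<longrightarrow>
        - (LINT x:V t|lebesgue. divg (\<lambda>s y. \<rho>\<^sub>m s y *\<^sub>R v s y) t x *\<^sub>R u t x)
        + total_deriv V (\<lambda>s y. \<rho>\<^sub>m s y *\<^sub>R w s y) t
        - (LINT x:V t|lebesgue.
             divg (\<lambda>s y. \<rho>\<^sub>m s y *\<^sub>R u s y) t x *\<^sub>R v t x
             + \<rho>\<^sub>m t x *\<^sub>R grad (\<lambda>s y. u s y \<bullet> v s y) t x)
        = (LINT x:V t|lebesgue.
             - grad P t x - grad p t x - \<rho> t x *\<^sub>R grad U t x)))"
proof -
  obtain G\<^sub>1 where G\<^sub>1: "open G\<^sub>1" "AE z in lborel. z \<in> G\<^sub>1" "twice_C1_on (case_prod \<rho>) G\<^sub>1"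
    using C2_ae_open_conull[OF \<rho>_C2] by blast
  obtain G\<^sub>2 where G\<^sub>2: "open G\<^sub>2" "AE z in lborel. z \<in> G\<^sub>2" "twice_C1_on (case_prod S) G\<^sub>2"
    using C2_ae_open_conull[OF S_C2] by blast
  have G\<^sub>0: "open (G\<^sub>1 \<inter> G\<^sub>2)" "AE z in lborel. z \<in> G\<^sub>1 \<inter> G\<^sub>2" "twice_C1_on (case_prod \<rho>) (G\<^sub>1 \<inter> G\<^sub>2)"
    using G\<^sub>1 G\<^sub>2 by (auto intro: twice_C1_on_subset)
  define G where "G = {z \<in> G\<^sub>1 \<inter> G\<^sub>2. case_prod \<rho> z \<noteq> 0}"
  have "continuous_on (G\<^sub>1 \<inter> G\<^sub>2) (case_prod \<rho>)"
    using G\<^sub>0(3) by (auto simp: twice_C1_on_def intro: C1_on_continuous)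
  note nz = nonzero_open_conull[OF G\<^sub>0(1,2) this \<rho>_zeros, folded G_def]
  have GG: "G \<subseteq> G\<^sub>1" "G \<subseteq> G\<^sub>2" by (auto simp: G_def)
  interpret smooth_flow m \<zeta>\<^sub>0 \<zeta> \<rho> S \<rho>\<^sub>m \<eta> P p u v w G
  proof
    show "twice_C1_on (case_prod \<rho>) G" by (rule twice_C1_on_subset[OF G\<^sub>1(1,3) GG(1)])
    show "twice_C1_on (case_prod S) G" by (rule twice_C1_on_subset[OF G\<^sub>2(1,3) GG(2)])
    show "\<rho> t x > 0" if "(t, x) \<in> G" for t x
      using that \<rho>_nonneg[of t x] by (auto simp: G_def less_le)
    show "\<zeta>\<^sub>0 > 0" using \<open>hbar > 0\<close> by (simp add: \<zeta>\<^sub>0)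
  qed (fact \<open>m > 0\<close> \<zeta> \<rho>\<^sub>m \<eta> v u w P p continuity nz(1))+
  have P_meas: "case_prod P \<in> borel_measurable lebesgue"
    by (rule lebesgue_measurable_continuous_on_conull[OF nz continuous_on_P])
  note gP = lebesgue_measurable_grad[OF P_meas P_gradient]
  note gU = lebesgue_measurable_grad[OF U_measurable U_gradient]
  have \<rho>U: "case_prod (\<lambda>t x. \<rho> t x *\<^sub>R grad U t x) \<in> borel_measurable lebesgue"
    using borel_measurable_scaleR[OF lebesgue_measurable_continuous_on_conull[OF nz C1_on_continuous[OF C1_\<rho>]] gU]
    by (simp add: case_prod_unfold)
  have \<eta>_cont: "continuous_on G (case_prod \<eta>)"
    using continuous_on_mult_left[OF C1_on_continuous[OF C1_\<rho>], of \<zeta>\<^sub>0] by (simp add: \<eta> case_prod_unfold)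
  have F\<^sub>2: "case_prod (\<lambda>t x. - grad P t x - \<rho> t x *\<^sub>R grad U t x + \<eta> t x *\<^sub>R grad (divg v) t x) \<in> borel_measurable lebesgue"
    using gP \<rho>U lebesgue_measurable_continuous_on_conull[OF nz continuous_on_scaleR[OF \<eta>_cont continuous_on_grad[OF C1_divg_v]]]
    unfolding case_prod_unfold by (intro borel_measurable_add borel_measurable_diff borel_measurable_uminus)
  have F\<^sub>3: "case_prod (\<lambda>t x. - grad P t x - grad p t x - \<rho> t x *\<^sub>R grad U t x) \<in> borel_measurable lebesgue"
    using gP \<rho>U lebesgue_measurable_continuous_on_conull[OF nz continuous_on_grad[OF C1_p]]
    unfolding case_prod_unfold by (intro borel_measurable_add borel_measurable_diff borel_measurable_uminus)
  have duv: "continuous_on G (case_prod (\<lambda>t x. divg (\<lambda>s y. \<rho>\<^sub>m s y *\<^sub>R u s y) t x *\<^sub>R v t x))"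
    using continuous_on_scaleR[OF continuous_on_divg[OF C1_scaleR_field[OF C1_\<rho>\<^sub>m C1_u]] C1_on_continuous[OF C1_v]]
    by (simp add: case_prod_unfold)
  have dvu: "continuous_on G (case_prod (\<lambda>t x. divg (\<lambda>s y. \<rho>\<^sub>m s y *\<^sub>R v s y) t x *\<^sub>R u t x))"
    using continuous_on_scaleR[OF continuous_on_divg[OF C1_scaleR_field[OF C1_\<rho>\<^sub>m C1_v]] C1_on_continuous[OF C1_u]]
    by (simp add: case_prod_unfold)
  have cross: "continuous_on G (case_prod (\<lambda>t x. divg (\<lambda>s y. \<rho>\<^sub>m s y *\<^sub>R u s y) t x *\<^sub>R v t x
      + \<rho>\<^sub>m t x *\<^sub>R grad (\<lambda>s y. u s y \<bullet> v s y) t x))"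
    using continuous_on_add[OF duv continuous_on_scaleR[OF C1_on_continuous[OF C1_\<rho>\<^sub>m] continuous_on_grad[OF C1_inner_uv]]]
    by (simp add: case_prod_unfold)
  have "eq1 \<longleftrightarrow> eq2"
    unfolding eq1_def eq2_def
  proof (rule eventually_subst, use nz(2) in eventually_elim, clarify)
    fix t x assume "(t, x) \<in> G"
    note a = acceleration_w[OF this]
    show "\<rho>\<^sub>m t x *\<^sub>R time_deriv v t x
        + (1 / 2 * \<rho>\<^sub>m t x) *\<^sub>R grad (\<lambda>s y. (norm (u s y))\<^sup>2 + (norm (v s y))\<^sup>2) t x
        + grad P t x + divg (\<lambda>s y. \<rho>\<^sub>m s y *\<^sub>R u s y) t x *\<^sub>R u t x + \<rho> t x *\<^sub>R grad U t x = 0 \<longleftrightarrow>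
      \<rho>\<^sub>m t x *\<^sub>R time_deriv w t x + (1 / 2 * \<rho>\<^sub>m t x) *\<^sub>R grad (\<lambda>s y. (norm (w s y))\<^sup>2) t x
        + grad P t x + \<rho> t x *\<^sub>R grad U t x + divg (\<lambda>s y. \<rho>\<^sub>m s y *\<^sub>R u s y) t x *\<^sub>R u t x
        = \<eta> t x *\<^sub>R grad (divg v) t x"
      unfolding a by (simp add: add.assoc) (simp add: ac_simps)
  qed
  moreover have "eq1 \<longleftrightarrow> eq3"
    unfolding eq1_def eq3_def
  \<comment> \<open>Besides membership in \<open>G\<close>, differentiability of \<open>P\<close> is
    used to split the gradient of \<open>P + p\<close>.\<close>
  proof (rule eventually_subst, use nz(2) P_gradient in eventually_elim, clarify)
    fix t x assume tx: "(t, x) \<in> G" and "P t differentiable at x"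
    then have "grad (\<lambda>s y. P s y + p s y) t x = grad P t x + grad p t x"
      by (intro grad_add C1_field_differentiable[OF C1_p])
    then show "\<rho>\<^sub>m t x *\<^sub>R time_deriv v t x
        + (1 / 2 * \<rho>\<^sub>m t x) *\<^sub>R grad (\<lambda>s y. (norm (u s y))\<^sup>2 + (norm (v s y))\<^sup>2) t x
        + grad P t x + divg (\<lambda>s y. \<rho>\<^sub>m s y *\<^sub>R u s y) t x *\<^sub>R u t x + \<rho> t x *\<^sub>R grad U t x = 0 \<longleftrightarrow>
      time_deriv (\<lambda>s y. \<rho>\<^sub>m s y *\<^sub>R u s y) t x + \<rho>\<^sub>m t x *\<^sub>R time_deriv v t x
        + (1 / 2 * \<rho>\<^sub>m t x) *\<^sub>R grad (\<lambda>s y. (norm (u s y))\<^sup>2 + (norm (v s y))\<^sup>2) t x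
        + grad (\<lambda>s y. P s y + p s y) t x
        + divg (\<lambda>s y. \<rho>\<^sub>m s y *\<^sub>R u s y) t x *\<^sub>R u t x + \<rho> t x *\<^sub>R grad U t x = 0"
      unfolding time_deriv_\<rho>\<^sub>m_u[OF tx] by (simp add: algebra_simps)
  qed
  \<comment> \<open>The summand 0 gives the equation the shape of
    \<open>integral_balance_iff\<close> with \<open>a = 0\<close>, because this integral form has a
    single correction term.\<close>
  moreover have "eq2 \<longleftrightarrow> (AE (t, x) in lborel. momentum_transport \<rho>\<^sub>m w t x - 0
      - divg (\<lambda>s y. \<rho>\<^sub>m s y *\<^sub>R u s y) t x *\<^sub>R v t x
      = - grad P t x - \<rho> t x *\<^sub>R grad U t x + \<eta> t x *\<^sub>R grad (divg v) t x)"
    unfolding eq2_def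
  proof (rule eventually_subst, use nz(2) in eventually_elim, clarify)
    fix t x assume "(t, x) \<in> G"
    note b = momentum_balance_w[OF this]
    show "\<rho>\<^sub>m t x *\<^sub>R time_deriv w t x + (1 / 2 * \<rho>\<^sub>m t x) *\<^sub>R grad (\<lambda>s y. (norm (w s y))\<^sup>2) t x
        + grad P t x + \<rho> t x *\<^sub>R grad U t x + divg (\<lambda>s y. \<rho>\<^sub>m s y *\<^sub>R u s y) t x *\<^sub>R u t x
        = \<eta> t x *\<^sub>R grad (divg v) t x \<longleftrightarrow>
      momentum_transport \<rho>\<^sub>m w t x - 0 - divg (\<lambda>s y. \<rho>\<^sub>m s y *\<^sub>R u s y) t x *\<^sub>R v t x
      = - grad P t x - \<rho> t x *\<^sub>R grad U t x + \<eta> t x *\<^sub>R grad (divg v) t x"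
      unfolding diff_zero b by (simp add: algebra_simps)
  qed
  moreover have "eq3 \<longleftrightarrow> (AE (t, x) in lborel. momentum_transport \<rho>\<^sub>m w t x
      - divg (\<lambda>s y. \<rho>\<^sub>m s y *\<^sub>R v s y) t x *\<^sub>R u t x
      - (divg (\<lambda>s y. \<rho>\<^sub>m s y *\<^sub>R u s y) t x *\<^sub>R v t x + \<rho>\<^sub>m t x *\<^sub>R grad (\<lambda>s y. u s y \<bullet> v s y) t x)
      = - grad P t x - grad p t x - \<rho> t x *\<^sub>R grad U t x)"
    unfolding eq3_def
  proof (rule eventually_subst, use nz(2) P_gradient in eventually_elim, clarify)
    fix t x assume tx: "(t, x) \<in> G" and "P t differentiable at x"
    then have "grad (\<lambda>s y. P s y + p s y) t x = grad P t x + grad p t x"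
      by (intro grad_add C1_field_differentiable[OF C1_p])
    then show "time_deriv (\<lambda>s y. \<rho>\<^sub>m s y *\<^sub>R u s y) t x + \<rho>\<^sub>m t x *\<^sub>R time_deriv v t x
        + (1 / 2 * \<rho>\<^sub>m t x) *\<^sub>R grad (\<lambda>s y. (norm (u s y))\<^sup>2 + (norm (v s y))\<^sup>2) t x
        + grad (\<lambda>s y. P s y + p s y) t x
        + divg (\<lambda>s y. \<rho>\<^sub>m s y *\<^sub>R u s y) t x *\<^sub>R u t x + \<rho> t x *\<^sub>R grad U t x = 0 \<longleftrightarrow>
      momentum_transport \<rho>\<^sub>m w t x - divg (\<lambda>s y. \<rho>\<^sub>m s y *\<^sub>R v s y) t x *\<^sub>R u t x
      - (divg (\<lambda>s y. \<rho>\<^sub>m s y *\<^sub>R u s y) t x *\<^sub>R v t x + \<rho>\<^sub>m t x *\<^sub>R grad (\<lambda>s y. u s y \<bullet> v s y) t x)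
      = - grad P t x - grad p t x - \<rho> t x *\<^sub>R grad U t x"
      unfolding momentum_balance_uv[OF tx] by (simp add: eq_diff_eq eq_neg_iff_add_eq_0 add.assoc) (simp add: ac_simps)
  qed
  moreover have zero: "continuous_on G (case_prod (\<lambda>t x. 0 :: real ^ 3))"
    "set_integrable lebesgue A (\<lambda>x. 0 :: real ^ 3) = True" "(LINT x:A|lebesgue. (0 :: real ^ 3)) = 0" for A
    by (simp_all add: set_integrable_def set_lebesgue_integral_def case_prod_unfold)
  moreover note integral_balance_iff[OF nz C1_\<rho>\<^sub>m C1_w zero(1) duv F\<^sub>2, unfolded zero(2,3) simp_thms minus_zero add_0]
    integral_balance_iff[OF nz C1_\<rho>\<^sub>m C1_w dvu cross F\<^sub>3]
  ultimately show ?thesis by (intro conjI) (simp_all only:)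
qed

end
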